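(* As $n \to \infty$, we have $$\sum_{f \in M_n} (\omega_1(f) - \log n)^2 = q^n \log n + c_3\, q^n + O\left(\frac{q^n \log n}{n}\right),$$ where $$c_3 := (A_1 - 2L(2))(A_1 + 1) - \frac{\pi^2}{6} + (L(2))^2 + 2L(3) - L(4).$$ Let $\epsilon' \in (0, 1/2)$. Then the number of monic polynomials $f \in \mathbb{F}_q[t]$ of degree $n$ such that $$\frac{|\omega_1(f) - \log n|}{\sqrt{\log n}} \geq (\log n)^{\epsilon'}$$ is $o(q^n)$ as $n \to \infty$, and thus $\omega_1(f)$ has normal order $\log(\deg(f))$.
   Context: $\mathbb{F}_q$ is the finite field with $q$ elements ($q$ a fixed prime power), and $\mathbb{F}_q[t]$ is its polynomial ring. $P$ is the set of monic irreducible polynomials in $\mathbb{F}_q[t]$; $M$ is the set of monic polynomials of degree $\ge 1$; for $n \ge 1$, $M_n$ is the set of monic polynomials of degree $n$. For $f \in \mathbb{F}_q[t]$ nonzero, $|f| := q^{\deg(f)}$. For $l \in P$ and $f \in M$, $\nu_l(f)$ is the largest nonnegative integer with $l^{\nu_l(f)} \mid f$, and $\omega_1(f)$ is the number of $l \in P$ with $\nu_l(f) = 1$. $\pi_q(r)$ is the number of $l \in P$ with $\deg(l) = r$. $\gamma$ is the Euler--Mascheroni constant, $c_1 := \sum_{r=1}^{\infty} \left(\pi_q(r) - \frac{q^r}{r}\right) q^{-r}$, and $A_1 := \gamma + c_1$. For an integer $m \geq 2$, $L(m) := \sum_{l \in P} \frac{1}{|l|^m}$. Normal order: let $g, G : M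 \to \mathbb{R}_{\geq 0}$. $G$ is non-decreasing if $G(f) \geq G(h)$ for all $f, h \in M$ with $\deg(f) \geq \deg(h)$. For a non-decreasing $G$, $g(f)$ is said to have normal order $G(f)$ if for any $\epsilon > 0$, the number of $f \in M_n$ that do not satisfy $(1-\epsilon) G(f) \leq g(f) \leq (1+\epsilon) G(f)$ is $o(q^n)$ as $n \to \infty$. *)

theory Defs
  imports
    "HOL-Analysis.Analysis"
    "HOL-Computational_Algebra.Computational_Algebra"
    "HOL-Library.Landau_Symbols"
begin

text \<open>
  The field with $q$ elements is an arbitrary type \<open>'a\<close> of class \<open>finite_field\<close>, with
  $q$ = \<open>CARD('a)\<close>. Constants that depend only on $q$ take a type token \<open>TYPE('a)\<close>.
\<close>

definition monic_irreducibles :: "'a::finite_field poly set" where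
  "monic_irreducibles = {l. lead_coeff l = 1 \<and> irreducible l}"

definition monic_nonconst :: "'a::finite_field poly set" where
  "monic_nonconst = {f. lead_coeff f = 1 \<and> degree f \<ge> 1}"

definition monic_of_degree :: "nat \<Rightarrow> 'a::finite_field poly set" where
  "monic_of_degree n = {f. lead_coeff f = 1 \<and> degree f = n}"

definition poly_abs :: "'a::finite_field poly \<Rightarrow> real" where
  "poly_abs f = real CARD('a) ^ degree f"

text \<open>
  The library's \<open>multiplicity\<close> is not available for polynomials over an arbitrary field, which
  lacks the required gcd and normalization structure on the coefficients. The maximum exists
  when \<open>f \<noteq> 0\<close> and \<open>l\<close> is not a unit.
\<close>

definition nu :: "'a::finite_field poly \<Rightarrow> 'a poly \<Rightarrow> nat" where
  "nu l f = (GREATEST k. l ^ k dvd f)"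

definition omega1 :: "'a::finite_field poly \<Rightarrow> nat" where
  "omega1 f = card {l \<in> monic_irreducibles. nu l f = 1}"

definition prime_count :: "'a::finite_field itself \<Rightarrow> nat \<Rightarrow> nat" where
  "prime_count _ r = card {l \<in> (monic_irreducibles :: 'a poly set). degree l = r}"

text \<open>The series over $r \ge 1$ is indexed from 0, hence the shift \<open>r = Suc k\<close>.\<close>

definition c1 :: "'a::finite_field itself \<Rightarrow> real" where
  "c1 T = (\<Sum>k. (real (prime_count T (Suc k)) - real CARD('a) ^ Suc k / real (Suc k))
                   / real CARD('a) ^ Suc k)"

definition A1 :: "'a::finite_field itself \<Rightarrow> real" where
  "A1 T = euler_mascheroni + c1 T"

definition Lsum :: "'a::finite_field itself \<Rightarrow> nat \<Rightarrow> real" where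
  "Lsum _ m = (\<Sum>\<^sub>\<infinity> l \<in> (monic_irreducibles :: 'a poly set). 1 / poly_abs l ^ m)"

definition c3 :: "'a::finite_field itself \<Rightarrow> real" where
  "c3 T = (A1 T - 2 * Lsum T 2) * (A1 T + 1) - pi\<^sup>2 / 6 + (Lsum T 2)\<^sup>2 + 2 * Lsum T 3 - Lsum T 4"

definition nondecreasing_in_degree :: "('a::finite_field poly \<Rightarrow> real) \<Rightarrow> bool" where
  "nondecreasing_in_degree G \<longleftrightarrow>
     (\<forall>f\<in>monic_nonconst. \<forall>h\<in>monic_nonconst. degree f \<ge> degree h \<longrightarrow> G f \<ge> G h)"

text \<open>
  Functions on \<open>monic_nonconst\<close> are represented by functions on all polynomials; the
  standing requirements on the pair (nonnegativity of both, monotonicity of the second) are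
  part of the predicate.
\<close>

definition has_normal_order ::
    "('a::finite_field poly \<Rightarrow> real) \<Rightarrow> ('a poly \<Rightarrow> real) \<Rightarrow> bool" where
  "has_normal_order g G \<longleftrightarrow>
     (\<forall>f\<in>monic_nonconst. g f \<ge> 0 \<and> G f \<ge> 0) \<and>
     nondecreasing_in_degree G \<and>
     (\<forall>\<epsilon>>0. (\<lambda>n. real (card {f \<in> monic_of_degree n.
                 \<not> ((1 - \<epsilon>) * G f \<le> g f \<and> g f \<le> (1 + \<epsilon>) * G f)}))
               \<in> o(\<lambda>n. real CARD('a) ^ n))"

end

theory Submission
  imports Defs "HOL-Real_Asymp.Real_Asymp"
begin

text \<open>
  Write $q$ for the size of the field and $\pi(d)$ for the number of monic irreducible polynomials
  of degree $d$. For $f$ in $M_n$, $\omega_1(f)$ is the sum over monic irreducible $l$ of the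
  indicator of $l \mid f$, $l^2 \nmid f$, that is, of a difference of two divisibility indicators.
  A monic $g$ of degree $k \le n$ divides exactly $q^{n-k}$ elements of $M_n$, and no element of
  $M_n$ if $k > n$. Powers of distinct irreducibles divide $f$ simultaneously iff their product
  does. Hence the sums of $\omega_1$ and of $\omega_1^2$ over $M_n$ equal $q^n$ times a finite
  combination of the sums of $\pi(d) q^{-kd}$ over $kd \le n$ and of the double sums of
  $\pi(d) q^{-id} \pi(e) q^{-je}$ over $id + je \le n$ (lemmas \<open>sum_omega1\<close> and
  \<open>sum_omega1_squared\<close>).

  The input on primes is the identity that the sum of $d \, \pi(d)$ over $d \mid n$ is $q^n$
  (\<open>sum_divisors_prime_count\<close>). It follows by summing over $M_n$ the identity that
  $\deg f$ is the sum of $\nu_l(f) \deg l$, and comparing the results for $n$ and $n - 1$. It gives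
  $\pi(d) q^{-d} = 1/d + \delta_d$ with $\delta_d \le 0$ exponentially small, and $c_1$ is the sum
  of the $\delta_d$.

  Two estimates then evaluate the truncated sums. If $\sum_d d |x_d|$ converges, truncating a sum of
  the $x_d$ at $kd \le n$ costs $O(1/n)$, and convolving $x$ with a sequence $v$,
  $0 \le v_e \le 1/e$, over $id + e \le n$ costs $O(\log n / n)$ against the product of
  $\sum_d x_d$ and $\sum_{e \le n} v_e$. The one sum to which these do not apply is the convolution
  of $1/d$ with itself, and it has the closed form $H_n^2 - \sum_{m \le n} 1/m^2$
  (\<open>trunc_conv_inverse_inverse\<close>), which is where $-\pi^2/6$ in $c_3$ comes from.
  Collecting terms, with $H_n = \log n + \gamma + O(1/n)$, gives the second moment about $\log n$.
  The two statements on the distribution of $\omega_1$ follow by Chebyshev's inequality, as the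
  second moment is $O(q^n \log n)$.
\<close>

section \<open>Counting monic multiples\<close>

lemma monic_of_degree_0: "monic_of_degree 0 = {1 :: 'a::finite_field poly}"
  by (auto simp: monic_of_degree_def elim!: degree_eq_zeroE)

lemma monic_of_degree_Suc:
  "monic_of_degree (Suc n) =
     (\<lambda>(c, g). pCons c g) ` (UNIV \<times> (monic_of_degree n :: 'a::finite_field poly set))"
proof (intro equalityI subsetI)
  fix f :: "'a poly" assume f: "f \<in> monic_of_degree (Suc n)"
  obtain c g where cg: "f = pCons c g" by (cases f)
  with f have "g \<noteq> 0" by (auto simp: monic_of_degree_def)
  with f cg have "g \<in> monic_of_degree n" by (auto simp: monic_of_degree_def)
  with cg show "f \<in> (\<lambda>(c, g). pCons c g) ` (UNIV \<times> monic_of_degree n)" by auto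
qed (auto simp: monic_of_degree_def)

lemma finite_monic_of_degree [simp]: "finite (monic_of_degree n :: 'a::finite_field poly set)"
  by (induction n) (simp_all add: monic_of_degree_0 monic_of_degree_Suc)

lemma card_monic_of_degree:
  "card (monic_of_degree n :: 'a::finite_field poly set) = CARD('a) ^ n"
proof (induction n)
  case (Suc n)
  have "inj_on (\<lambda>(c, g). pCons c g) (UNIV \<times> (monic_of_degree n :: 'a poly set))"
    by (auto simp: inj_on_def)
  with Suc show ?case by (simp add: monic_of_degree_Suc card_image)
qed (simp add: monic_of_degree_0)

lemma card_monic_multiples:
  fixes g :: "'a::finite_field poly"
  assumes "lead_coeff g = 1"
  shows "real (card {f \<in> monic_of_degree n. g dvd f}) =
           real CARD('a) ^ n * (of_bool (degree g \<le> n) / real CARD('a) ^ degree g)"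
proof (cases "degree g \<le> n")
  case True
  have g0: "g \<noteq> 0" using assms by auto
  have "{f \<in> monic_of_degree n. g dvd f} = (\<lambda>h. g * h) ` monic_of_degree (n - degree g)"
  proof (intro equalityI subsetI)
    fix f assume f: "f \<in> {f \<in> monic_of_degree n. g dvd f}"
    then obtain h where h: "f = g * h" by auto
    with f have "h \<noteq> 0" by (auto simp: monic_of_degree_def)
    moreover have "lead_coeff f = lead_coeff g * lead_coeff h"
      unfolding h by (rule lead_coeff_mult)
    ultimately have "h \<in> monic_of_degree (n - degree g)"
      using f h g0 assms by (auto simp: monic_of_degree_def degree_mult_eq)
    with h show "f \<in> (\<lambda>h. g * h) ` monic_of_degree (n - degree g)" by auto
  next
    fix f assume "f \<in> (\<lambda>h. g * h) ` monic_of_degree (n - degree g)"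
    then obtain h where h: "f = g * h" "lead_coeff h = 1" "degree h = n - degree g"
      unfolding monic_of_degree_def by blast
    hence "h \<noteq> 0" by auto
    moreover have "lead_coeff f = lead_coeff g * lead_coeff h"
      unfolding h(1) by (rule lead_coeff_mult)
    ultimately show "f \<in> {f \<in> monic_of_degree n. g dvd f}"
      using h g0 assms True by (auto simp: monic_of_degree_def degree_mult_eq)
  qed
  moreover have "inj_on (\<lambda>h. g * h) (monic_of_degree (n - degree g))"
    using g0 by (auto simp: inj_on_def)
  ultimately have "card {f \<in> monic_of_degree n. g dvd f} = CARD('a) ^ (n - degree g)"
    by (simp add: card_image card_monic_of_degree)
  hence "real (card {f \<in> monic_of_degree n. g dvd f}) = real CARD('a) ^ (n - degree g)"
    by simp
  also have "\<dots> = real CARD('a) ^ n / real CARD('a) ^ degree g"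
    using True by (intro power_diff) simp_all
  finally show ?thesis using True by simp
next
  case False
  have "{f \<in> monic_of_degree n. g dvd f} = {}"
    using False by (auto simp: monic_of_degree_def dest!: dvd_imp_degree_le)
  with False show ?thesis by simp
qed

lemma sum_dvd_indicator:
  fixes g :: "'a::finite_field poly"
  assumes "lead_coeff g = 1"
  shows "(\<Sum>f\<in>monic_of_degree n. of_bool (g dvd f)) =
           real CARD('a) ^ n * (of_bool (degree g \<le> n) / real CARD('a) ^ degree g)"
proof -
  have "(\<Sum>f\<in>monic_of_degree n. of_bool (g dvd f)) = real (card {f \<in> monic_of_degree n. g dvd f})"
    by (simp add: sum_of_bool_eq Int_def)
  with card_monic_multiples[OF assms] show ?thesis by simp
qed

section \<open>Irreducible factors and their multiplicities\<close>

lemma monic_irreducible_degree_pos: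
  "l \<in> monic_irreducibles \<Longrightarrow> degree l > 0" for l :: "'a::finite_field poly"
  by (rule ccontr) (auto simp: monic_irreducibles_def irreducible_def is_unit_iff_degree)

lemma monic_irreducible_not_unit:
  "l \<in> monic_irreducibles \<Longrightarrow> \<not> l dvd 1" for l :: "'a::finite_field poly"
  by (auto simp: monic_irreducibles_def irreducible_def)

lemma monic_irreducible_prime_elem:
  "l \<in> monic_irreducibles \<Longrightarrow> prime_elem l" for l :: "'a::finite_field poly"
  by (auto simp: monic_irreducibles_def intro: field_poly_irreducible_imp_prime)

lemma monic_irreducible_dvd_eq:
  fixes l m :: "'a::finite_field poly"
  assumes "l \<in> monic_irreducibles" "m \<in> monic_irreducibles" "l dvd m"
  shows "l = m"
proof -
  obtain k where k: "m = l * k" using assms(3) by auto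
  have "irreducible m" "\<not> is_unit l"
    using assms(2) monic_irreducible_not_unit[OF assms(1)] by (auto simp: monic_irreducibles_def)
  with k have "is_unit k" by (auto dest: irreducibleD)
  then obtain c where c: "k = [:c:]" by (auto elim: is_unit_polyE)
  have "lead_coeff m = lead_coeff l * lead_coeff k" by (simp add: k lead_coeff_mult)
  with assms c have "c = 1" by (simp add: monic_irreducibles_def)
  with c k show ?thesis by simp
qed

lemma exists_monic_irreducible_dvd:
  fixes f :: "'a::finite_field poly"
  assumes "degree f > 0"
  shows "\<exists>l\<in>monic_irreducibles. l dvd f"
  using assms
proof (induction "degree f" arbitrary: f rule: less_induct)
  case less
  have f0: "f \<noteq> 0" using less.prems by auto
  show ?case
  proof (cases "irreducible f")
    case True
    define l where "l = smult (inverse (lead_coeff f)) f"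
    have "lead_coeff l = 1" "l dvd f" using f0 by (auto simp: l_def smult_dvd_iff)
    moreover have "l = [:inverse (lead_coeff f):] * f" by (simp add: l_def)
    hence "irreducible l"
      using True f0 irreducible_mult_unit_left[of "[:inverse (lead_coeff f):]" f]
      by (simp only: is_unit_triv) (simp add: is_unit_triv)
    ultimately show ?thesis by (auto simp: monic_irreducibles_def)
  next
    case False
    have "\<not> is_unit f" using less.prems by (auto simp: is_unit_iff_degree f0)
    then obtain g h where gh: "f = g * h" "\<not> is_unit g" "\<not> is_unit h"
      using False f0 by (auto simp: irreducible_def)
    have nz: "g \<noteq> 0" "h \<noteq> 0" using gh f0 by auto
    hence "degree g > 0" "degree h > 0" using gh by (auto simp: is_unit_iff_degree)
    moreover from this have "degree g < degree f" using gh nz by (simp add: degree_mult_eq)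
    ultimately obtain l where "l \<in> monic_irreducibles" "l dvd g" using less.hyps by blast
    thus ?thesis unfolding gh(1) by (blast intro: dvd_mult2)
  qed
qed

lemma degree_power_monic:
  "lead_coeff l = 1 \<Longrightarrow> degree (l ^ k) = k * degree l" for l :: "'a::finite_field poly"
  by (cases "l = 0") (auto simp: degree_power_eq)

lemma prime_power_dvd_bound:
  fixes l f :: "'a::finite_field poly"
  assumes "l \<in> monic_irreducibles" "f \<noteq> 0" "l ^ k dvd f"
  shows "k * degree l \<le> degree f"
  using dvd_imp_degree_le[OF assms(3,2)] assms(1)
  by (simp add: monic_irreducibles_def degree_power_monic)

text \<open>
  The set of exponents in the definition of \<open>nu\<close> is bounded, because each power of \<open>l\<close>
  contributes at least 1 to the degree, so the maximum is attained.
\<close>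

lemma le_nu_iff:
  fixes l f :: "'a::finite_field poly"
  assumes "l \<in> monic_irreducibles" "f \<noteq> 0"
  shows "k \<le> nu l f \<longleftrightarrow> l ^ k dvd f"
proof -
  have bd: "k \<le> degree f" if "l ^ k dvd f" for k
  proof -
    have "k * 1 \<le> k * degree l"
      using monic_irreducible_degree_pos[OF assms(1)] by (intro mult_le_mono2) simp
    also have "\<dots> \<le> degree f" by (rule prime_power_dvd_bound[OF assms that])
    finally show ?thesis by simp
  qed
  have "l ^ nu l f dvd f"
    unfolding nu_def by (rule GreatestI_nat[where k = 0]) (use bd in auto)
  moreover have "k \<le> nu l f" if "l ^ k dvd f" for k
    unfolding nu_def by (rule Greatest_le_nat[where b = "degree f"]) (use bd that in auto)
  ultimately show ?thesis by (meson dvd_trans le_imp_power_dvd)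
qed

lemma nu_eq_1_iff:
  fixes l f :: "'a::finite_field poly"
  assumes "l \<in> monic_irreducibles" "f \<noteq> 0"
  shows "nu l f = 1 \<longleftrightarrow> l dvd f \<and> \<not> l\<^sup>2 dvd f"
  using le_nu_iff[OF assms, of 1] le_nu_iff[OF assms, of 2] by auto

lemma nu_mult_irreducible:
  fixes l p g :: "'a::finite_field poly"
  assumes l: "l \<in> monic_irreducibles" and p: "p \<in> monic_irreducibles" and g: "g \<noteq> 0"
  shows "nu l (p * g) = nu l g + of_bool (l = p)"
proof -
  have p0: "p \<noteq> 0" using p by (auto simp: monic_irreducibles_def)
  have pg: "p * g \<noteq> 0" using g p0 by auto
  have iff: "k \<le> nu l (p * g) \<longleftrightarrow> k \<le> nu l g + of_bool (l = p)" for k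
  proof (cases "l = p")
    case True
    show ?thesis
      by (cases k) (use True p0 le_nu_iff[OF l pg] le_nu_iff[OF l g] in auto)
  next
    case False
    hence "\<not> l dvd p" using monic_irreducible_dvd_eq[OF l p] by auto
    have "l ^ k dvd p * g \<longleftrightarrow> l ^ k dvd g"
    proof
      assume *: "l ^ k dvd p * g"
      show "l ^ k dvd g"
      proof (cases "k = 0")
        case False
        with * show ?thesis
          by (intro prime_power_dvd_multD[OF monic_irreducible_prime_elem[OF l], of k p g])
             (use \<open>\<not> l dvd p\<close> in auto)
      qed simp
    qed (rule dvd_mult)
    with False show ?thesis using le_nu_iff[OF l pg] le_nu_iff[OF l g] by auto
  qed
  show ?thesis using iff[of "nu l (p * g)"] iff[of "nu l g + of_bool (l = p)"] by auto
qed

section \<open>The prime polynomial identity\<close>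

text \<open>
  The monic irreducible polynomials of degree at most \<open>n\<close>: a finite set that contains every
  monic irreducible factor of a monic polynomial of degree \<open>n\<close>.
\<close>

definition irreducibles_upto :: "nat \<Rightarrow> 'a::finite_field poly set" where
  "irreducibles_upto n = {l \<in> monic_irreducibles. degree l \<le> n}"

lemma finite_irreducibles_upto [simp]: "finite (irreducibles_upto n :: 'a::finite_field poly set)"
proof (rule finite_subset)
  show "irreducibles_upto n \<subseteq> (\<Union>d\<le>n. monic_of_degree d :: 'a poly set)"
    by (auto simp: irreducibles_upto_def monic_irreducibles_def monic_of_degree_def)
qed simp

lemma sum_irreducibles_upto:
  fixes g :: "nat \<Rightarrow> real"
  shows "(\<Sum>l\<in>(irreducibles_upto n :: 'a::finite_field poly set). g (degree l)) =
           (\<Sum>d\<le>n. real (prime_count TYPE('a) d) * g d)"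
proof -
  have "(\<Sum>l\<in>(irreducibles_upto n :: 'a poly set). g (degree l)) =
          (\<Sum>d\<le>n. \<Sum>l\<in>{l \<in> (irreducibles_upto n :: 'a poly set). degree l = d}. g (degree l))"
    by (rule sum.group[symmetric]) (simp, auto simp: irreducibles_upto_def)
  also have "\<dots> = (\<Sum>d\<le>n. real (prime_count TYPE('a) d) * g d)"
  proof (rule sum.cong[OF refl])
    fix d assume "d \<in> {..n}"
    hence "{l \<in> (irreducibles_upto n :: 'a poly set). degree l = d} =
             {l \<in> monic_irreducibles. degree l = d}"
      by (auto simp: irreducibles_upto_def)
    thus "(\<Sum>l\<in>{l \<in> (irreducibles_upto n :: 'a poly set). degree l = d}. g (degree l)) =
            real (prime_count TYPE('a) d) * g d"
      by (simp add: prime_count_def)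
  qed
  finally show ?thesis .
qed

lemma prime_count_0 [simp]: "prime_count TYPE('a::finite_field) 0 = 0"
  by (auto simp: prime_count_def card_eq_0_iff dest: monic_irreducible_degree_pos)

text \<open>
  Unique factorization in terms of degrees: \<open>f\<close> is the product of the powers $l^{\nu_l(f)}$.
\<close>

lemma sum_nu_degree:
  fixes f :: "'a::finite_field poly"
  assumes "lead_coeff f = 1" "degree f \<le> N"
  shows "(\<Sum>l\<in>irreducibles_upto N. nu l f * degree l) = degree f"
  using assms
proof (induction "degree f" arbitrary: f rule: less_induct)
  case less
  show ?case
  proof (cases "degree f = 0")
    case True
    have "f = 1" using True less.prems by (auto elim: degree_eq_zeroE)
    moreover have "nu l 1 = 0" if "l \<in> irreducibles_upto N" for l :: "'a poly"
      using that le_nu_iff[of l 1 1] monic_irreducible_not_unit[of l]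
      by (auto simp: irreducibles_upto_def)
    ultimately show ?thesis by simp
  next
    case False
    then obtain p where p: "p \<in> monic_irreducibles" "p dvd f"
      using exists_monic_irreducible_dvd[of f] by blast
    then obtain g where g: "f = p * g" by (auto elim: dvdE)
    have p1: "lead_coeff p = 1" using p by (simp add: monic_irreducibles_def)
    hence p0: "p \<noteq> 0" by auto
    have g0: "g \<noteq> 0" using g False by auto
    have "lead_coeff f = lead_coeff p * lead_coeff g" unfolding g by (rule lead_coeff_mult)
    hence g1: "lead_coeff g = 1" using p1 less.prems by simp
    have deg: "degree f = degree p + degree g" using g p0 g0 by (simp add: degree_mult_eq)
    have pos: "degree p > 0" by (rule monic_irreducible_degree_pos[OF p(1)])
    have pN: "p \<in> irreducibles_upto N"
      using p(1) deg less.prems by (auto simp: irreducibles_upto_def)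
    have "(\<Sum>l\<in>irreducibles_upto N. nu l f * degree l) =
            (\<Sum>l\<in>irreducibles_upto N. nu l g * degree l + of_bool (l = p) * degree l)"
      using nu_mult_irreducible[OF _ p(1) g0] g
      by (intro sum.cong refl) (simp add: irreducibles_upto_def algebra_simps)
    also have "\<dots> = degree g + degree p"
      using less.hyps[of g] g1 deg pos less.prems pN
      by (simp add: sum.distrib of_bool_def if_distrib[where f = "\<lambda>x. x * _"] sum.delta cong: if_cong)
    finally show ?thesis using deg by simp
  qed
qed

lemma nu_eq_sum:
  fixes f l :: "'a::finite_field poly"
  assumes "l \<in> monic_irreducibles" "f \<noteq> 0" "degree f \<le> N"
  shows "nu l f = (\<Sum>k=1..N. of_bool (l ^ k dvd f))"
proof -
  have "nu l f * 1 \<le> nu l f * degree l"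
    using monic_irreducible_degree_pos[OF assms(1)] by (intro mult_le_mono2) simp
  also have "\<dots> \<le> degree f"
    using le_nu_iff[OF assms(1,2), of "nu l f"] by (intro prime_power_dvd_bound assms) simp
  finally have "nu l f \<le> N" using assms(3) by simp
  have "(\<Sum>k=1..N. of_bool (l ^ k dvd f)) = (\<Sum>k=1..N. of_bool (k \<le> nu l f))"
    using le_nu_iff[OF assms(1,2)] by simp
  also have "\<dots> = card ({1..N} \<inter> {k. k \<le> nu l f})" by (simp add: sum_of_bool_eq)
  also have "{1..N} \<inter> {k. k \<le> nu l f} = {1..nu l f}" using \<open>nu l f \<le> N\<close> by auto
  finally show ?thesis by simp
qed

text \<open>
  The identity \<open>sum_nu_degree\<close>, summed over the monic polynomials of degree \<open>n\<close>
  and divided by their number. The bound \<open>N\<close> is independent of \<open>n\<close>, so that the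
  identities for \<open>n\<close> and \<open>n - 1\<close> can be subtracted termwise.
\<close>

lemma degree_as_sum_over_prime_powers:
  assumes "n \<le> N"
  shows "real n = (\<Sum>d\<le>N. \<Sum>k=1..N. of_bool (k * d \<le> n) *
            (real (d * prime_count TYPE('a::finite_field) d) / real CARD('a) ^ (k * d)))"
proof -
  let ?q = "real CARD('a)" and ?M = "monic_of_degree n :: 'a poly set"
  let ?P = "irreducibles_upto N :: 'a poly set"
  have "real n * ?q ^ n = (\<Sum>f\<in>?M. real (degree f))"
    by (simp add: monic_of_degree_def card_monic_of_degree[unfolded monic_of_degree_def])
  also have "\<dots> = (\<Sum>f\<in>?M. \<Sum>l\<in>?P. \<Sum>k=1..N. of_bool (l ^ k dvd f) * real (degree l))"
  proof (rule sum.cong[OF refl])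
    fix f assume "f \<in> ?M"
    hence f: "lead_coeff f = 1" "degree f = n" by (auto simp: monic_of_degree_def)
    have "real (degree f) = real (\<Sum>l\<in>?P. nu l f * degree l)"
      using sum_nu_degree[of f N] f assms by simp
    also have "\<dots> = (\<Sum>l\<in>?P. real (nu l f) * real (degree l))" by simp
    also have "\<dots> = (\<Sum>l\<in>?P. \<Sum>k=1..N. of_bool (l ^ k dvd f) * real (degree l))"
    proof (rule sum.cong[OF refl])
      fix l assume "l \<in> ?P"
      moreover have "f \<noteq> 0" using f by auto
      ultimately have "nu l f = (\<Sum>k=1..N. of_bool (l ^ k dvd f))"
        using f assms by (intro nu_eq_sum) (auto simp: irreducibles_upto_def)
      hence "real (nu l f) = (\<Sum>k=1..N. of_bool (l ^ k dvd f))" by simp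
      thus "real (nu l f) * real (degree l) = (\<Sum>k=1..N. of_bool (l ^ k dvd f) * real (degree l))"
        by (simp add: sum_distrib_right)
    qed
    finally show "real (degree f) =
      (\<Sum>l\<in>?P. \<Sum>k=1..N. of_bool (l ^ k dvd f) * real (degree l))" .
  qed
  also have "\<dots> = (\<Sum>l\<in>?P. \<Sum>k=1..N. \<Sum>f\<in>?M. of_bool (l ^ k dvd f) * real (degree l))"
    by (subst sum.swap, rule sum.cong[OF refl], rule sum.swap)
  also have "\<dots> = (\<Sum>l\<in>?P. \<Sum>k=1..N. real (degree l) * (?q ^ n *
                      (of_bool (k * degree l \<le> n) / ?q ^ (k * degree l))))"
  proof (intro sum.cong refl)
    fix l k assume "l \<in> ?P"
    hence l: "lead_coeff l = 1" by (auto simp: irreducibles_upto_def monic_irreducibles_def)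
    hence "lead_coeff (l ^ k) = 1" by (simp only: lead_coeff_power power_one)
    thus "(\<Sum>f\<in>?M. of_bool (l ^ k dvd f) * real (degree l)) =
            real (degree l) * (?q ^ n * (of_bool (k * degree l \<le> n) / ?q ^ (k * degree l)))"
      using l by (simp only: sum_distrib_right[symmetric] sum_dvd_indicator degree_power_monic)
                 (simp only: mult_ac)
  qed
  also have "\<dots> = (\<Sum>d\<le>N. real (prime_count TYPE('a) d) * (\<Sum>k=1..N. real d * (?q ^ n *
                      (of_bool (k * d \<le> n) / ?q ^ (k * d)))))"
    by (rule sum_irreducibles_upto)
  also have "\<dots> = ?q ^ n * (\<Sum>d\<le>N. \<Sum>k=1..N. of_bool (k * d \<le> n) *
            (real (d * prime_count TYPE('a) d) / ?q ^ (k * d)))"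
    unfolding sum_distrib_left by (intro sum.cong refl) (simp add: field_simps)
  finally show ?thesis by simp
qed

text \<open>
  Only the terms with $kd = n$ survive in the difference of the identities for \<open>n\<close> and
  \<open>n - 1\<close>.
\<close>

theorem sum_divisors_prime_count:
  assumes "n > 0"
  shows "(\<Sum>d | d dvd n. d * prime_count TYPE('a::finite_field) d) = CARD('a) ^ n"
proof -
  let ?q = "real CARD('a)" and ?c = "\<lambda>d. real (d * prime_count TYPE('a) d)"
  have "1 = real n - real (n - 1)" using assms by simp
  also have "\<dots> = (\<Sum>d\<le>n. \<Sum>k=1..n. of_bool (k * d \<le> n) * (?c d / ?q ^ (k * d)))
                - (\<Sum>d\<le>n. \<Sum>k=1..n. of_bool (k * d \<le> n - 1) * (?c d / ?q ^ (k * d)))"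
    using degree_as_sum_over_prime_powers[where 'a = 'a, of n n]
          degree_as_sum_over_prime_powers[where 'a = 'a, of "n - 1" n] by simp
  also have "\<dots> = (\<Sum>d\<le>n. \<Sum>k=1..n. of_bool (k * d = n) * (?c d / ?q ^ n))"
    unfolding sum_subtractf[symmetric] using assms by (intro sum.cong refl) auto
  also have "\<dots> = (\<Sum>d\<le>n. of_bool (d dvd n) * (?c d / ?q ^ n))"
  proof (rule sum.cong[OF refl])
    fix d
    have "(\<Sum>k=1..n. of_bool (k * d = n)) = (of_bool (d dvd n) :: real)"
    proof (cases "d dvd n")
      case True
      then obtain e where e: "n = d * e" by auto
      with assms have "{1..n} \<inter> {k. k * d = n} = {e}" by auto
      with True show ?thesis by (simp add: sum_of_bool_eq)
    next
      case False
      hence "k * d \<noteq> n" for k by auto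
      with False show ?thesis by simp
    qed
    thus "(\<Sum>k=1..n. of_bool (k * d = n) * (?c d / ?q ^ n)) = of_bool (d dvd n) * (?c d / ?q ^ n)"
      by (simp only: sum_distrib_right[symmetric])
  qed
  also have "\<dots> = (\<Sum>d | d dvd n. ?c d / ?q ^ n)"
    using assms by (intro sum.mono_neutral_cong_right) (auto dest: dvd_imp_le)
  also have "\<dots> = (\<Sum>d | d dvd n. ?c d) / ?q ^ n" by (simp add: sum_divide_distrib)
  finally have "(\<Sum>d | d dvd n. ?c d) = ?q ^ n" by (simp add: field_simps)
  hence "real (\<Sum>d | d dvd n. d * prime_count TYPE('a) d) = real (CARD('a) ^ n)" by simp
  thus ?thesis by (rule of_nat_eq_iff[THEN iffD1])
qed

section \<open>Estimates for the number of irreducibles\<close>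

lemma two_le_card: "2 \<le> CARD('a::finite_field)"
proof -
  have "card {0, 1 :: 'a} \<le> CARD('a)" by (rule card_mono) simp_all
  thus ?thesis by simp
qed

lemma degree_mult_prime_count_le:
  "d * prime_count TYPE('a::finite_field) d \<le> CARD('a) ^ d"
proof (cases "d = 0")
  case False
  have "d * prime_count TYPE('a) d \<le> (\<Sum>e | e dvd d. e * prime_count TYPE('a) e)"
    using False by (intro member_le_sum) auto
  also have "\<dots> = CARD('a) ^ d" using False by (intro sum_divisors_prime_count) simp
  finally show ?thesis .
qed simp

lemma sum_powers_le:
  assumes "2 \<le> (q::nat)"
  shows "(\<Sum>e\<le>m. q ^ e) \<le> 2 * q ^ m"
proof (induction m)
  case (Suc m)
  have "2 * q ^ m \<le> q * q ^ m" using assms by (intro mult_right_mono) auto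
  thus ?case using Suc unfolding sum.atMost_Suc power_Suc by linarith
qed simp

text \<open>
  A proper divisor of \<open>d\<close> is at most \<open>d div 2\<close>, so the other terms of the divisor sum
  are bounded by a geometric sum.
\<close>

lemma card_power_le_prime_count:
  assumes "d > 0"
  shows "CARD('a::finite_field) ^ d \<le> d * prime_count TYPE('a) d + 2 * CARD('a) ^ (d div 2)"
proof -
  let ?c = "\<lambda>e. e * prime_count TYPE('a) e"
  have "{e. e dvd d} = insert d ({e. e dvd d} - {d})" by auto
  hence "CARD('a) ^ d = (\<Sum>e\<in>insert d ({e. e dvd d} - {d}). ?c e)"
    using sum_divisors_prime_count[where 'a = 'a, OF assms] by simp
  also have "\<dots> = ?c d + (\<Sum>e\<in>{e. e dvd d} - {d}. ?c e)"
    using assms by (intro sum.insert) auto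
  also have "(\<Sum>e\<in>{e. e dvd d} - {d}. ?c e) \<le> (\<Sum>e\<le>d div 2. ?c e)"
  proof (rule sum_mono2)
    show "{e. e dvd d} - {d} \<subseteq> {..d div 2}"
    proof
      fix e assume "e \<in> {e. e dvd d} - {d}"
      then obtain k where k: "d = e * k" "e \<noteq> d" by auto
      with assms have "k \<ge> 2" by (cases k; cases "k - 1") auto
      hence "e * 2 \<le> d" unfolding k(1) by (rule mult_le_mono2)
      thus "e \<in> {..d div 2}" by auto
    qed
  qed auto
  also have "\<dots> \<le> (\<Sum>e\<le>d div 2. CARD('a) ^ e)"
    by (intro sum_mono degree_mult_prime_count_le)
  also have "\<dots> \<le> 2 * CARD('a) ^ (d div 2)" by (rule sum_powers_le[OF two_le_card])
  finally show ?thesis by simp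
qed

text \<open>
  The total mass $\pi(d) q^{-md}$ of the irreducibles of degree \<open>d\<close> when each \<open>l\<close>
  is weighted by $|l|^{-m}$.
\<close>

definition prime_weight :: "'a::finite_field itself \<Rightarrow> nat \<Rightarrow> nat \<Rightarrow> real" where
  "prime_weight T m d = real (prime_count T d) / real CARD('a) ^ (m * d)"

text \<open>
  The deviation $\delta_d$ of the weight $\pi(d) q^{-d}$ from $1/d$. Both terms are 0 at \<open>d = 0\<close>,
  since division by 0 yields 0.
\<close>

definition prime_error :: "'a::finite_field itself \<Rightarrow> nat \<Rightarrow> real" where
  "prime_error T d = prime_weight T 1 d - 1 / real d"

lemma prime_weight_0 [simp]: "prime_weight TYPE('a::finite_field) m 0 = 0"
  by (simp add: prime_weight_def)

lemma prime_error_0 [simp]: "prime_error TYPE('a::finite_field) 0 = 0"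
  by (simp add: prime_error_def)

lemma prime_weight_nonneg: "prime_weight TYPE('a::finite_field) m d \<ge> 0"
  by (simp add: prime_weight_def)

lemma degree_mult_prime_weight_le:
  assumes "m \<ge> 1"
  shows "real d * prime_weight TYPE('a::finite_field) m d \<le> (1 / 2) ^ ((m - 1) * d)"
proof -
  let ?q = "real CARD('a)"
  have q: "?q \<ge> 2" using two_le_card[where 'a = 'a] by simp
  obtain k where k: "m = Suc k" using assms by (cases m) auto
  have "real (d * prime_count TYPE('a) d) \<le> real (CARD('a) ^ d)"
    using degree_mult_prime_count_le[where 'a = 'a, of d] by (intro of_nat_mono)
  hence "real d * prime_weight TYPE('a) m d \<le> ?q ^ d / ?q ^ (m * d)"
    by (simp add: prime_weight_def divide_right_mono)
  also have "\<dots> = (1 / ?q) ^ (k * d)" by (simp add: k power_add power_one_over)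
  also have "\<dots> \<le> (1 / 2) ^ (k * d)" using q by (intro power_mono) (auto simp: field_simps)
  finally show ?thesis by (simp add: k)
qed

lemma prime_weight_1_le: "prime_weight TYPE('a::finite_field) 1 d \<le> 1 / real d"
  using degree_mult_prime_weight_le[where 'a = 'a, of 1 d] by (cases "d = 0") (auto simp: field_simps)

lemma summable_prime_weight:
  assumes "m \<ge> 2"
  shows "summable (\<lambda>d. real d * \<bar>prime_weight TYPE('a::finite_field) m d\<bar>)"
proof (rule summable_comparison_test')
  show "summable (\<lambda>d. (1 / 2 :: real) ^ d)" by (rule summable_geometric) simp
  fix d :: nat
  have "real d * prime_weight TYPE('a) m d \<le> (1 / 2) ^ ((m - 1) * d)"
    using assms by (intro degree_mult_prime_weight_le) simp
  also have "\<dots> \<le> (1 / 2) ^ d" using assms by (intro power_decreasing) auto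
  finally show "norm (real d * \<bar>prime_weight TYPE('a) m d\<bar>) \<le> (1 / 2) ^ d"
    by (simp add: prime_weight_nonneg)
qed

text \<open>
  By \<open>card_power_le_prime_count\<close>, $d |\delta_d|$ is at most $2 q^{-\lceil d/2 \rceil}$.
\<close>

lemma summable_prime_error: "summable (\<lambda>d. real d * \<bar>prime_error TYPE('a::finite_field) d\<bar>)"
proof (rule summable_comparison_test')
  show "summable (\<lambda>d. 2 * sqrt (1 / 2) ^ d)"
    by (intro summable_mult summable_geometric) (simp add: real_sqrt_divide)
  fix d :: nat
  let ?q = "real CARD('a)"
  have q: "?q \<ge> 2" using two_le_card[where 'a = 'a] by simp
  show "norm (real d * \<bar>prime_error TYPE('a) d\<bar>) \<le> 2 * sqrt (1 / 2) ^ d"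
  proof (cases "d = 0")
    case False
    define e where "e = d - d div 2"
    have "real d * \<bar>prime_error TYPE('a) d\<bar> = 1 - real d * prime_weight TYPE('a) 1 d"
      using prime_weight_1_le[where 'a = 'a, of d] False
      by (simp add: prime_error_def abs_if field_simps)
    also have "\<dots> \<le> 2 * ?q ^ (d div 2) / ?q ^ d"
    proof -
      have "real (CARD('a) ^ d) \<le> real (d * prime_count TYPE('a) d + 2 * CARD('a) ^ (d div 2))"
        using False by (intro of_nat_mono card_power_le_prime_count) simp
      hence "?q ^ d - real d * real (prime_count TYPE('a) d) \<le> 2 * ?q ^ (d div 2)" by simp
      hence "(?q ^ d - real d * real (prime_count TYPE('a) d)) / ?q ^ d \<le> 2 * ?q ^ (d div 2) / ?q ^ d"
        by (intro divide_right_mono) simp_all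
      thus ?thesis by (simp add: prime_weight_def diff_divide_distrib)
    qed
    also have "?q ^ d = ?q ^ (d div 2) * ?q ^ e" by (simp add: e_def flip: power_add)
    also have "2 * ?q ^ (d div 2) / (?q ^ (d div 2) * ?q ^ e) = 2 * (1 / ?q) ^ e"
      by (simp add: power_one_over)
    also have "\<dots> \<le> 2 * (1 / 2) ^ e"
      using q by (intro mult_left_mono power_mono) (auto simp: field_simps)
    also have "(1 / 2 :: real) ^ e = sqrt (1 / 2) ^ (2 * e)" by (simp add: power_mult)
    also have "2 * sqrt (1 / 2) ^ (2 * e) \<le> 2 * sqrt (1 / 2) ^ d"
      unfolding e_def by (intro mult_left_mono power_decreasing) auto
    finally show ?thesis by simp
  qed simp
qed

text \<open>
  The factor \<open>d\<close> only helps from \<open>d = 1\<close> on; the term at 0 does not affect convergence.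
\<close>

lemma summable_of_weighted:
  fixes x :: "nat \<Rightarrow> real"
  assumes "summable (\<lambda>d. real d * \<bar>x d\<bar>)"
  shows "summable x"
proof (rule summable_comparison_test'[OF assms, of 1])
  fix d :: nat assume "1 \<le> d"
  hence "1 * \<bar>x d\<bar> \<le> real d * \<bar>x d\<bar>" by (intro mult_right_mono) auto
  thus "norm (x d) \<le> real d * \<bar>x d\<bar>" by simp
qed

lemma c1_eq_suminf: "c1 TYPE('a::finite_field) = (\<Sum>d. prime_error TYPE('a) d)"
proof -
  have "(\<Sum>d. prime_error TYPE('a) d) = (\<Sum>k. prime_error TYPE('a) (Suc k))"
    using suminf_split_head[OF summable_of_weighted[OF summable_prime_error[where 'a = 'a]]] by simp
  also have "\<dots> = c1 TYPE('a)"
    unfolding c1_def by (intro suminf_cong) (simp add: prime_error_def prime_weight_def field_simps)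
  finally show ?thesis ..
qed

lemma Lsum_eq_suminf:
  assumes "m \<ge> 2"
  shows "Lsum TYPE('a::finite_field) m = (\<Sum>d. prime_weight TYPE('a) m d)"
proof -
  let ?B = "\<lambda>d. {l \<in> (monic_irreducibles :: 'a poly set). degree l = d}"
  let ?f = "\<lambda>l::'a poly. 1 / poly_abs l ^ m"
  have fin: "finite (?B d)" for d
    by (rule finite_subset[OF _ finite_irreducibles_upto[of d]]) (auto simp: irreducibles_upto_def)
  have inner: "(?f has_sum prime_weight TYPE('a) m d) (?B d)" for d
  proof -
    have "(\<Sum>l\<in>?B d. ?f l) = prime_weight TYPE('a) m d"
      by (simp add: poly_abs_def prime_weight_def prime_count_def power_mult[symmetric] mult.commute)
    thus ?thesis using has_sum_finite[OF fin, of ?f d] by simp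
  qed
  have outer: "(prime_weight TYPE('a) m has_sum (\<Sum>d. prime_weight TYPE('a) m d)) UNIV"
    using summable_of_weighted[OF summable_prime_weight[OF assms]]
    by (intro sums_nonneg_imp_has_sum summable_sums prime_weight_nonneg)
  have "((\<lambda>(d, l). ?f l) has_sum (\<Sum>d. prime_weight TYPE('a) m d)) (Sigma UNIV ?B)"
  proof (rule has_sum_SigmaI[OF _ outer])
    show "(\<lambda>(d, l). ?f l) summable_on Sigma UNIV ?B"
      using inner outer
      by (intro summable_on_SigmaI[where g = "prime_weight TYPE('a) m"])
         (auto simp: poly_abs_def has_sum_imp_summable)
  qed (use inner in simp)
  also have "?this \<longleftrightarrow> (?f has_sum (\<Sum>d. prime_weight TYPE('a) m d)) monic_irreducibles"
    by (rule has_sum_reindex_bij_witness[of _ "\<lambda>l. (degree l, l)" snd]) auto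
  finally show ?thesis unfolding Lsum_def by (rule infsumI)
qed

section \<open>The first two moments as truncated sums\<close>

text \<open>
  The partial sum of \<open>x\<close> over the \<open>d\<close> with $kd \le n$. For $k \ge 1$ the range
  \<open>d \<le> n\<close> is no further restriction; it makes the sum finite in all cases.
\<close>

definition trunc_sum :: "nat \<Rightarrow> (nat \<Rightarrow> real) \<Rightarrow> nat \<Rightarrow> real" where
  "trunc_sum k x n = (\<Sum>d\<le>n. of_bool (k * d \<le> n) * x d)"

text \<open>
  The double sum of $x_d y_e$ over the pairs with $id + je \le n$, with ranges made finite in the same
  way.
\<close>

definition trunc_conv :: "nat \<Rightarrow> nat \<Rightarrow> (nat \<Rightarrow> real) \<Rightarrow> (nat \<Rightarrow> real) \<Rightarrow> nat \<Rightarrow> real" where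
  "trunc_conv i j x y n = (\<Sum>d\<le>n. \<Sum>e\<le>n. of_bool (i * d + j * e \<le> n) * (x d * y e))"

lemma trunc_conv_commute: "trunc_conv i j x y n = trunc_conv j i y x n"
  unfolding trunc_conv_def by (subst sum.swap) (simp add: add.commute mult.commute)

lemma irreducible_powers_mult_dvd_iff:
  fixes l m f :: "'a::finite_field poly"
  assumes "l \<in> monic_irreducibles" "m \<in> monic_irreducibles" "l \<noteq> m"
  shows "l ^ i * m ^ j dvd f \<longleftrightarrow> l ^ i dvd f \<and> m ^ j dvd f"
proof safe
  assume l: "l ^ i dvd f" and "m ^ j dvd f"
  then obtain h where h: "f = m ^ j * h" by (auto elim: dvdE)
  have "\<not> l dvd m ^ j"
    using prime_elem_dvd_power[OF monic_irreducible_prime_elem[OF assms(1)], of m j]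
          monic_irreducible_dvd_eq[OF assms(1,2)] assms(3) by blast
  hence "l ^ i dvd h"
    using prime_power_dvd_multD[OF monic_irreducible_prime_elem[OF assms(1)], of i "m ^ j" h] l
    unfolding h by (cases "i = 0") simp_all
  hence "m ^ j * l ^ i dvd m ^ j * h" by (intro mult_dvd_mono dvd_refl)
  thus "l ^ i * m ^ j dvd f" unfolding h by (simp only: mult.commute)
qed (auto dest: dvd_mult_left dvd_mult_right)

text \<open>
  The indicator that \<open>l\<close> divides \<open>f\<close> exactly once, written as a difference so that
  products of such indicators expand into divisibility indicators.
\<close>

definition exact_indicator :: "'a::finite_field poly \<Rightarrow> 'a poly \<Rightarrow> real" where
  "exact_indicator l f = of_bool (l dvd f) - of_bool (l\<^sup>2 dvd f)"

lemma omega1_eq_sum: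
  fixes f :: "'a::finite_field poly"
  assumes "f \<in> monic_of_degree n"
  shows "real (omega1 f) = (\<Sum>l\<in>irreducibles_upto n. exact_indicator l f)"
proof -
  have f: "f \<noteq> 0" "degree f = n" using assms by (auto simp: monic_of_degree_def)
  have "degree l \<le> n" if "l \<in> monic_irreducibles" "nu l f = 1" for l
    using that f nu_eq_1_iff[of l f] by (auto dest: dvd_imp_degree_le)
  hence "{l \<in> monic_irreducibles. nu l f = 1} = irreducibles_upto n \<inter> {l. nu l f = 1}"
    by (auto simp: irreducibles_upto_def)
  hence "real (omega1 f) = (\<Sum>l\<in>irreducibles_upto n. of_bool (nu l f = 1))"
    by (simp add: omega1_def sum_of_bool_eq)
  also have "\<dots> = (\<Sum>l\<in>irreducibles_upto n. exact_indicator l f)"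
  proof (rule sum.cong[OF refl])
    fix l :: "'a poly" assume "l \<in> irreducibles_upto n"
    hence "l \<in> monic_irreducibles" by (simp add: irreducibles_upto_def)
    moreover have "l dvd f" if "l\<^sup>2 dvd f"
      using that by (auto simp: power2_eq_square dest: dvd_mult_left)
    ultimately show "of_bool (nu l f = 1) = exact_indicator l f"
      using nu_eq_1_iff[of l f] f(1) by (auto simp: exact_indicator_def)
  qed
  finally show ?thesis .
qed

text \<open>
  The proportion of the monic polynomials of degree \<open>n\<close> that are multiples of a given monic
  polynomial of degree \<open>k\<close>.
\<close>

definition multiple_density :: "'a::finite_field itself \<Rightarrow> nat \<Rightarrow> nat \<Rightarrow> real" where
  "multiple_density _ n k = of_bool (k \<le> n) / real CARD('a) ^ k"

lemma sum_power_dvd_indicator: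
  fixes l :: "'a::finite_field poly"
  assumes "l \<in> monic_irreducibles"
  shows "(\<Sum>f\<in>monic_of_degree n. of_bool (l ^ i dvd f)) =
           real CARD('a) ^ n * multiple_density TYPE('a) n (i * degree l)"
proof -
  have l: "lead_coeff l = 1" using assms by (simp add: monic_irreducibles_def)
  hence "lead_coeff (l ^ i) = 1" by (simp only: lead_coeff_power power_one)
  thus ?thesis using l by (simp only: sum_dvd_indicator degree_power_monic multiple_density_def)
qed

lemma sum_two_powers_dvd_indicator:
  fixes l m :: "'a::finite_field poly"
  assumes "l \<in> monic_irreducibles" "m \<in> monic_irreducibles" "l \<noteq> m"
  shows "(\<Sum>f\<in>monic_of_degree n. of_bool (l ^ i dvd f) * of_bool (m ^ j dvd f)) =
           real CARD('a) ^ n * multiple_density TYPE('a) n (i * degree l + j * degree m)"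
proof -
  have lm: "lead_coeff l = 1" "lead_coeff m = 1" using assms by (simp_all add: monic_irreducibles_def)
  hence "lead_coeff (l ^ i * m ^ j) = 1" by (simp only: lead_coeff_mult lead_coeff_power power_one mult_1)
  moreover have "degree (l ^ i * m ^ j) = i * degree l + j * degree m"
    using lm by (subst degree_mult_eq) (auto simp: degree_power_monic)
  moreover have "of_bool (l ^ i dvd f) * of_bool (m ^ j dvd f) = (of_bool (l ^ i * m ^ j dvd f) :: real)" for f
    using irreducible_powers_mult_dvd_iff[OF assms, of i j f] by simp
  ultimately show ?thesis by (simp only: sum_dvd_indicator multiple_density_def)
qed

lemma sum_exact_indicator:
  fixes l :: "'a::finite_field poly"
  assumes "l \<in> monic_irreducibles"
  shows "(\<Sum>f\<in>monic_of_degree n. exact_indicator l f) = real CARD('a) ^ n *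
           (multiple_density TYPE('a) n (degree l) - multiple_density TYPE('a) n (2 * degree l))"
  using sum_power_dvd_indicator[OF assms, where n = n and i = 1]
    sum_power_dvd_indicator[OF assms, where n = n and i = 2]
  by (simp add: exact_indicator_def sum_subtractf right_diff_distrib)

lemma sum_exact_indicator_mult:
  fixes l m :: "'a::finite_field poly"
  assumes "l \<in> monic_irreducibles" "m \<in> monic_irreducibles" "l \<noteq> m"
  defines "w \<equiv> multiple_density TYPE('a)"
  shows "(\<Sum>f\<in>monic_of_degree n. exact_indicator l f * exact_indicator m f) = real CARD('a) ^ n *
           (w n (degree l + degree m) - w n (2 * degree l + degree m)
             - w n (degree l + 2 * degree m) + w n (2 * degree l + 2 * degree m))"
proof -
  note * = sum_two_powers_dvd_indicator[OF assms(1-3), where n = n]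
  have "(\<Sum>f\<in>monic_of_degree n. exact_indicator l f * exact_indicator m f) =
          (\<Sum>f\<in>monic_of_degree n. of_bool (l ^ 1 dvd f) * of_bool (m ^ 1 dvd f))
          - (\<Sum>f\<in>monic_of_degree n. of_bool (l ^ 2 dvd f) * of_bool (m ^ 1 dvd f))
          - (\<Sum>f\<in>monic_of_degree n. of_bool (l ^ 1 dvd f) * of_bool (m ^ 2 dvd f))
          + (\<Sum>f\<in>monic_of_degree n. of_bool (l ^ 2 dvd f) * of_bool (m ^ 2 dvd f))"
    unfolding sum_subtractf[symmetric] sum.distrib[symmetric]
    by (intro sum.cong refl) (simp only: exact_indicator_def power_one_right algebra_simps)
  thus ?thesis unfolding * by (simp add: w_def algebra_simps)
qed

lemma exact_indicator_idem: "exact_indicator l f * exact_indicator l f = exact_indicator l f"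
  by (auto simp: exact_indicator_def power2_eq_square dest: dvd_mult_left)

lemma sum_density_eq_trunc_sum:
  assumes "k \<ge> 1"
  shows "(\<Sum>l\<in>(irreducibles_upto n :: 'a::finite_field poly set).
            multiple_density TYPE('a) n (k * degree l)) = trunc_sum k (prime_weight TYPE('a) k) n"
  unfolding sum_irreducibles_upto[of "\<lambda>d. multiple_density TYPE('a) n (k * d)"] trunc_sum_def
  by (intro sum.cong refl) (simp add: multiple_density_def prime_weight_def)

lemma sum_density_eq_trunc_conv:
  "(\<Sum>l\<in>(irreducibles_upto n :: 'a::finite_field poly set). \<Sum>m\<in>(irreducibles_upto n :: 'a poly set).
      multiple_density TYPE('a) n (i * degree l + j * degree m)) =
     trunc_conv i j (prime_weight TYPE('a) i) (prime_weight TYPE('a) j) n"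
proof -
  have "(\<Sum>l\<in>(irreducibles_upto n :: 'a poly set). \<Sum>m\<in>(irreducibles_upto n :: 'a poly set).
          multiple_density TYPE('a) n (i * degree l + j * degree m)) =
        (\<Sum>d\<le>n. real (prime_count TYPE('a) d) * (\<Sum>e\<le>n. real (prime_count TYPE('a) e) *
           multiple_density TYPE('a) n (i * d + j * e)))"
    by (simp only: sum_irreducibles_upto[where g = "\<lambda>e. multiple_density TYPE('a) n (_ + j * e)"]
          sum_irreducibles_upto[where g = "\<lambda>d. \<Sum>e\<le>n. real (prime_count TYPE('a) e) *
             multiple_density TYPE('a) n (i * d + j * e)"])
  also have "\<dots> = trunc_conv i j (prime_weight TYPE('a) i) (prime_weight TYPE('a) j) n"
    unfolding trunc_conv_def sum_distrib_left
    by (intro sum.cong refl) (simp add: multiple_density_def prime_weight_def power_add)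
  finally show ?thesis .
qed

lemma sum_omega1:
  "(\<Sum>f\<in>(monic_of_degree n :: 'a::finite_field poly set). real (omega1 f)) = real CARD('a) ^ n *
     (trunc_sum 1 (prime_weight TYPE('a) 1) n - trunc_sum 2 (prime_weight TYPE('a) 2) n)"
proof -
  let ?M = "monic_of_degree n :: 'a poly set" and ?P = "irreducibles_upto n :: 'a poly set"
  have "(\<Sum>f\<in>?M. real (omega1 f)) = (\<Sum>l\<in>?P. \<Sum>f\<in>?M. exact_indicator l f)"
    by (subst sum.swap) (simp add: omega1_eq_sum)
  also have "\<dots> = (\<Sum>l\<in>?P. real CARD('a) ^ n *
        (multiple_density TYPE('a) n (1 * degree l) - multiple_density TYPE('a) n (2 * degree l)))"
    by (intro sum.cong refl) (simp add: sum_exact_indicator irreducibles_upto_def)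
  also have "\<dots> = real CARD('a) ^ n *
     (trunc_sum 1 (prime_weight TYPE('a) 1) n - trunc_sum 2 (prime_weight TYPE('a) 2) n)"
    by (simp only: sum_distrib_left[symmetric] sum_subtractf sum_density_eq_trunc_sum order_refl one_le_numeral)
  finally show ?thesis .
qed

text \<open>
  The double sum over pairs of irreducibles is completed by the diagonal, where the product formula
  for distinct irreducibles does not hold. The correction on the diagonal, \<open>h\<close> below, is the
  true value \<open>w(d) - w(2d)\<close> minus \<open>w(2d) - 2 w(3d) + w(4d)\<close>, where \<open>w\<close> is
  the density of multiples.
\<close>

lemma sum_omega1_squared:
  defines "p \<equiv> prime_weight TYPE('a::finite_field)"
  shows "(\<Sum>f\<in>(monic_of_degree n :: 'a poly set). (real (omega1 f))\<^sup>2) = real CARD('a) ^ n *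
     (trunc_conv 1 1 (p 1) (p 1) n - 2 * trunc_conv 2 1 (p 2) (p 1) n + trunc_conv 2 2 (p 2) (p 2) n
      + trunc_sum 1 (p 1) n - 2 * trunc_sum 2 (p 2) n + 2 * trunc_sum 3 (p 3) n - trunc_sum 4 (p 4) n)"
proof -
  let ?M = "monic_of_degree n :: 'a poly set" and ?P = "irreducibles_upto n :: 'a poly set"
  let ?Q = "real CARD('a) ^ n"
  define w where "w = multiple_density TYPE('a) n"
  define g where "g = (\<lambda>d e. w (1 * d + 1 * e) - w (2 * d + 1 * e) - w (1 * d + 2 * e) + w (2 * d + 2 * e))"
  define h where "h = (\<lambda>d. w (1 * d) - 2 * w (2 * d) + 2 * w (3 * d) - w (4 * d))"
  have "(\<Sum>f\<in>?M. (real (omega1 f))\<^sup>2) =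
          (\<Sum>f\<in>?M. \<Sum>l\<in>?P. \<Sum>m\<in>?P. exact_indicator l f * exact_indicator m f)"
    by (intro sum.cong refl) (simp add: omega1_eq_sum power2_eq_square sum_product)
  also have "\<dots> = (\<Sum>l\<in>?P. \<Sum>m\<in>?P. \<Sum>f\<in>?M. exact_indicator l f * exact_indicator m f)"
    by (subst sum.swap, rule sum.cong[OF refl], rule sum.swap)
  also have "\<dots> = (\<Sum>l\<in>?P. \<Sum>m\<in>?P. ?Q * (g (degree l) (degree m) + (if m = l then h (degree l) else 0)))"
  proof (intro sum.cong refl)
    fix l m assume "l \<in> ?P" "m \<in> ?P"
    hence lm: "l \<in> monic_irreducibles" "m \<in> monic_irreducibles" by (auto simp: irreducibles_upto_def)
    show "(\<Sum>f\<in>?M. exact_indicator l f * exact_indicator m f) =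
            ?Q * (g (degree l) (degree m) + (if m = l then h (degree l) else 0))"
    proof (cases "m = l")
      case True
      thus ?thesis using sum_exact_indicator[OF lm(1), of n]
        by (simp add: exact_indicator_idem g_def h_def w_def flip: mult_2)
    next
      case False
      thus ?thesis using sum_exact_indicator_mult[OF lm, of n] by (simp add: g_def w_def)
    qed
  qed
  also have "\<dots> = ?Q * ((\<Sum>l\<in>?P. \<Sum>m\<in>?P. g (degree l) (degree m)) + (\<Sum>l\<in>?P. h (degree l)))"
    by (simp add: sum_distrib_left[symmetric] sum.distrib sum.delta)
  also have "(\<Sum>l\<in>?P. \<Sum>m\<in>?P. g (degree l) (degree m)) =
      trunc_conv 1 1 (p 1) (p 1) n - trunc_conv 2 1 (p 2) (p 1) n - trunc_conv 1 2 (p 1) (p 2) n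
      + trunc_conv 2 2 (p 2) (p 2) n"
    unfolding g_def p_def sum_density_eq_trunc_conv[symmetric] w_def by (simp only: sum.distrib sum_subtractf)
  also have "trunc_conv 1 2 (p 1) (p 2) n = trunc_conv 2 1 (p 2) (p 1) n" by (rule trunc_conv_commute)
  also have "(\<Sum>l\<in>?P. h (degree l)) =
      trunc_sum 1 (p 1) n - 2 * trunc_sum 2 (p 2) n + 2 * trunc_sum 3 (p 3) n - trunc_sum 4 (p 4) n"
    unfolding h_def w_def p_def
    by (simp only: sum.distrib sum_subtractf sum_distrib_left[symmetric] sum_density_eq_trunc_sum order_refl one_le_numeral)
  finally show ?thesis by (simp add: algebra_simps)
qed

section \<open>Truncation errors\<close>

text \<open>
  The sum $\sum_d d |x_d|$, to be used when it converges.
\<close>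

definition first_moment :: "(nat \<Rightarrow> real) \<Rightarrow> real" where
  "first_moment x = (\<Sum>d. real d * \<bar>x d\<bar>)"

text \<open>
  The common source of the truncation estimates: if the factors $\Phi_d$ deviate from \<open>L\<close> at
  most linearly in \<open>d\<close>, the weighted sum deviates from \<open>L\<close> times the full sum by
  the slope times the first moment. In the applications $\Phi_d$ is an indicator or an inner
  truncated sum, which vanishes for \<open>d > n\<close>.
\<close>

lemma weighted_sum_error:
  fixes x \<Phi> :: "nat \<Rightarrow> real"
  assumes summ: "summable (\<lambda>d. real d * \<bar>x d\<bar>)" and "x 0 = 0"
    and close: "\<And>d. d \<ge> 1 \<Longrightarrow> \<bar>\<Phi> d - L\<bar> \<le> K * real d"
    and tail: "\<And>d. d > n \<Longrightarrow> \<Phi> d = 0"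
  shows "\<bar>(\<Sum>d\<le>n. x d * \<Phi> d) - L * (\<Sum>d. x d)\<bar> \<le> K * first_moment x"
proof -
  have "(\<lambda>d. x d * \<Phi> d) sums (\<Sum>d\<le>n. x d * \<Phi> d)"
    by (rule sums_finite) (auto simp: tail)
  moreover have "(\<lambda>d. L * x d) sums (L * (\<Sum>d. x d))"
    by (rule sums_mult[OF summable_sums[OF summable_of_weighted[OF summ]]])
  ultimately have "(\<lambda>d. x d * \<Phi> d - L * x d) sums ((\<Sum>d\<le>n. x d * \<Phi> d) - L * (\<Sum>d. x d))"
    by (rule sums_diff)
  hence "(\<Sum>d\<le>n. x d * \<Phi> d) - L * (\<Sum>d. x d) = (\<Sum>d. x d * \<Phi> d - L * x d)"
    by (rule sums_unique)
  also have "norm \<dots> \<le> (\<Sum>d. K * (real d * \<bar>x d\<bar>))"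
  proof (rule norm_suminf_le)
    fix d
    show "norm (x d * \<Phi> d - L * x d) \<le> K * (real d * \<bar>x d\<bar>)"
    proof (cases "d = 0")
      case False
      have "norm (x d * \<Phi> d - L * x d) = \<bar>x d\<bar> * \<bar>\<Phi> d - L\<bar>"
        by (simp add: abs_mult[symmetric] algebra_simps)
      also have "\<dots> \<le> \<bar>x d\<bar> * (K * real d)"
        using close[of d] False by (intro mult_left_mono) auto
      finally show ?thesis by (simp add: mult_ac)
    qed (use assms in simp)
  qed (intro summable_mult summ)
  also have "\<dots> = K * first_moment x"
    unfolding first_moment_def by (rule suminf_mult[OF summ])
  finally show ?thesis by simp
qed

text \<open>
  A missing term has $kd > n$, so its indicator is at most $kd/n$.
\<close>

lemma trunc_sum_error:
  assumes "summable (\<lambda>d. real d * \<bar>x d\<bar>)" "x 0 = 0" "k \<ge> 1" "n \<ge> 1"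
  shows "\<bar>trunc_sum k x n - (\<Sum>d. x d)\<bar> \<le> real k / real n * first_moment x"
proof -
  have "\<bar>(\<Sum>d\<le>n. x d * of_bool (k * d \<le> n)) - 1 * (\<Sum>d. x d)\<bar> \<le> real k / real n * first_moment x"
  proof (rule weighted_sum_error[OF assms(1,2)])
    fix d :: nat
    show "\<bar>of_bool (k * d \<le> n) - 1 :: real\<bar> \<le> real k / real n * real d"
      using assms(4) by (simp add: field_simps flip: of_nat_mult)
  next
    fix d assume "d > n"
    moreover have "1 * d \<le> k * d" using assms(3) by (rule mult_le_mono1)
    ultimately have "\<not> k * d \<le> n" by linarith
    thus "of_bool (k * d \<le> n) = (0::real)" by simp
  qed
  thus ?thesis by (simp add: trunc_sum_def mult.commute)
qed

text \<open>
  A missing pair has $n < id + je \le (i + j) d e$; \<open>weighted_sum_error\<close> is applied first in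
  \<open>e\<close> and then in \<open>d\<close>.
\<close>

lemma trunc_conv_summable_error:
  assumes "summable (\<lambda>d. real d * \<bar>x d\<bar>)" "x 0 = 0"
    and "summable (\<lambda>d. real d * \<bar>y d\<bar>)" "y 0 = 0" and "i \<ge> 1" "j \<ge> 1" "n \<ge> 1"
  shows "\<bar>trunc_conv i j x y n - (\<Sum>d. x d) * (\<Sum>d. y d)\<bar>
           \<le> real (i + j) / real n * first_moment y * first_moment x"
proof -
  have le_mult: "d \<le> c * d" if "c \<ge> 1" for c d :: nat
    using mult_le_mono1[OF that, of d] by simp
  let ?\<Phi> = "\<lambda>d. \<Sum>e\<le>n. y e * of_bool (i * d + j * e \<le> n)"
  have "\<bar>(\<Sum>d\<le>n. x d * ?\<Phi> d) - (\<Sum>d. y d) * (\<Sum>d. x d)\<bar>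
          \<le> real (i + j) / real n * first_moment y * first_moment x"
  proof (rule weighted_sum_error[OF assms(1,2)])
    fix d :: nat assume d: "d \<ge> 1"
    have "\<bar>?\<Phi> d - 1 * (\<Sum>d. y d)\<bar> \<le> real ((i + j) * d) / real n * first_moment y"
    proof (rule weighted_sum_error[OF assms(3,4)])
      fix e :: nat assume e: "e \<ge> 1"
      have "i * d + j * e \<le> i * (d * e) + j * (d * e)"
        using d e by (intro add_mono mult_le_mono2) simp_all
      also have "\<dots> = (i + j) * d * e" by (simp add: algebra_simps)
      finally have *: "real (i * d + j * e) \<le> real ((i + j) * d * e)" by (rule of_nat_mono)
      show "\<bar>of_bool (i * d + j * e \<le> n) - 1 :: real\<bar> \<le> real ((i + j) * d) / real n * real e"
      proof (cases "i * d + j * e \<le> n")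
        case False
        hence "real n \<le> real (i * d + j * e)" by (intro of_nat_mono) simp
        also note *
        finally have "real n \<le> real ((i + j) * d * e)" .
        hence "1 \<le> real ((i + j) * d * e) / real n" using assms(7) by (simp add: le_divide_eq)
        with False show ?thesis by simp
      qed simp
    next
      fix e assume "e > n"
      hence "\<not> i * d + j * e \<le> n" using le_mult[OF assms(6), of e] by linarith
      thus "of_bool (i * d + j * e \<le> n) = (0::real)" by simp
    qed
    thus "\<bar>?\<Phi> d - (\<Sum>d. y d)\<bar> \<le> real (i + j) / real n * first_moment y * real d"
      by (simp add: mult_ac)
  next
    fix d assume "d > n"
    hence "\<not> i * d + j * e \<le> n" for e using le_mult[OF assms(5), of d] by linarith
    thus "?\<Phi> d = 0" by (intro sum.neutral) simp
  qed
  also have "(\<Sum>d\<le>n. x d * ?\<Phi> d) = trunc_conv i j x y n"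
    unfolding trunc_conv_def sum_distrib_left by (intro sum.cong refl) simp
  finally show ?thesis by (simp add: mult.commute)
qed

lemma trunc_sum_inverse_eq_harm: "trunc_sum 1 (\<lambda>d. 1 / real d) n = harm n"
  by (induction n) (simp_all add: trunc_sum_def harm_Suc harm_expand inverse_eq_divide)

text \<open>
  The slowly convergent factor \<open>v\<close> is truncated at $n - id$ instead of \<open>n\<close>. The missing
  terms satisfy $n < id + e$, so $1/e \le (id/n)(1/e) + 1/n$, and there are at most $id$ values of
  \<open>e\<close> in the resulting range. Their sum is therefore at most $(id/n)(H_n + 1)$.
\<close>

lemma trunc_conv_harmonic_error:
  assumes "summable (\<lambda>d. real d * \<bar>x d\<bar>)" "x 0 = 0"
    and v: "\<And>e. 0 \<le> v e" "\<And>e. v e \<le> 1 / real e" and "i \<ge> 1" "n \<ge> 1"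
  shows "\<bar>trunc_conv i 1 x v n - trunc_sum 1 v n * (\<Sum>d. x d)\<bar>
           \<le> real i * ((harm n + 1) / real n) * first_moment x"
proof -
  let ?\<Phi> = "\<lambda>d. \<Sum>e\<le>n. of_bool (i * d + 1 * e \<le> n) * v e"
  have "\<bar>(\<Sum>d\<le>n. x d * ?\<Phi> d) - trunc_sum 1 v n * (\<Sum>d. x d)\<bar>
          \<le> real i * ((harm n + 1) / real n) * first_moment x"
  proof (rule weighted_sum_error[OF assms(1,2)])
    fix d :: nat
    let ?J = "{n + 1 - i * d..n}"
    have "trunc_sum 1 v n - ?\<Phi> d = (\<Sum>e\<le>n. of_bool (n < i * d + e) * v e)"
      unfolding trunc_sum_def sum_subtractf[symmetric] by (intro sum.cong refl) auto
    also have "\<dots> = (\<Sum>e\<in>?J. v e)"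
      by (intro sum.mono_neutral_cong_right) auto
    finally have eq: "trunc_sum 1 v n - ?\<Phi> d = (\<Sum>e\<in>?J. v e)" .
    have "(\<Sum>e\<in>?J. v e) \<le> (\<Sum>e\<in>?J. (real (i * d) / real n) * (1 / real e) + 1 / real n)"
    proof (rule sum_mono)
      fix e assume e: "e \<in> ?J"
      show "v e \<le> (real (i * d) / real n) * (1 / real e) + 1 / real n"
      proof (cases "e = 0")
        case True
        have "v 0 \<le> 0" using v(2)[of 0] by simp
        also have "0 \<le> 1 / real n" by simp
        finally show ?thesis using True by simp
      next
        case False
        have "real n \<le> real (i * d + e)" using e by (intro of_nat_mono) auto
        hence "real n / (real n * real e) \<le> real (i * d + e) / (real n * real e)"
          by (intro divide_right_mono) simp_all
        hence "1 / real e \<le> (real (i * d) / real n) * (1 / real e) + 1 / real n"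
          using False assms(6) by (simp add: add_divide_distrib)
        with v(2)[of e] show ?thesis by linarith
      qed
    qed
    also have "\<dots> = (real (i * d) / real n) * (\<Sum>e\<in>?J. 1 / real e) + real (card ?J) / real n"
      by (simp add: sum.distrib sum_distrib_left)
    also have "\<dots> \<le> (real (i * d) / real n) * harm n + real (i * d) / real n"
    proof (intro add_mono mult_left_mono divide_right_mono of_nat_mono)
      have "(\<Sum>e\<in>?J. 1 / real e) \<le> (\<Sum>e\<le>n. 1 / real e)" by (intro sum_mono2) auto
      also have "\<dots> = harm n"
        unfolding trunc_sum_inverse_eq_harm[symmetric] trunc_sum_def by simp
      finally show "(\<Sum>e\<in>?J. 1 / real e) \<le> harm n" .
    qed auto
    also have "\<dots> = real i * ((harm n + 1) / real n) * real d"
      by (simp add: add_divide_distrib algebra_simps)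
    finally have "(\<Sum>e\<in>?J. v e) \<le> real i * ((harm n + 1) / real n) * real d" .
    moreover have "(\<Sum>e\<in>?J. v e) \<ge> 0" by (intro sum_nonneg v)
    ultimately show "\<bar>?\<Phi> d - trunc_sum 1 v n\<bar> \<le> real i * ((harm n + 1) / real n) * real d"
      using eq by linarith
  next
    fix d assume "d > n"
    moreover have "1 * d \<le> i * d" using assms(5) by (rule mult_le_mono1)
    ultimately have "\<not> i * d + 1 * e \<le> n" for e by linarith
    thus "?\<Phi> d = 0" by (intro sum.neutral) simp
  qed
  also have "(\<Sum>d\<le>n. x d * ?\<Phi> d) = trunc_conv i 1 x v n"
    unfolding trunc_conv_def sum_distrib_left by (intro sum.cong refl) simp
  finally show ?thesis .
qed

section \<open>Harmonic sums\<close>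

text \<open>
  Partial fractions. The end points \<open>i = 0\<close> and \<open>i = Suc m\<close> contribute 0, as division
  by 0 yields 0.
\<close>

lemma sum_inverse_mult_reflected:
  "(\<Sum>i\<le>Suc m. 1 / real i * (1 / real (Suc m - i))) = 2 * harm m / real (Suc m)"
proof -
  have harm: "(\<Sum>i=1..m. 1 / real i) = harm m" by (simp add: harm_def inverse_eq_divide)
  have "(\<Sum>i\<le>Suc m. 1 / real i * (1 / real (Suc m - i))) = (\<Sum>i=1..m. 1 / real i * (1 / real (Suc m - i)))"
    by (rule sum.mono_neutral_right) (auto simp: not_le)
  also have "\<dots> = (\<Sum>i=1..m. (1 / real i + 1 / real (m + 1 - i)) / real (Suc m))"
    by (intro sum.cong refl) (auto simp: of_nat_diff divide_simps)
  also have "\<dots> = ((\<Sum>i=1..m. 1 / real i) + (\<Sum>i=1..m. 1 / real (m + 1 - i))) / real (Suc m)"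
    by (simp only: sum_divide_distrib[symmetric] sum.distrib)
  also have "(\<Sum>i=1..m. 1 / real (m + 1 - i)) = (\<Sum>i=1..m. 1 / real i)"
    by (rule sum.atLeastAtMost_rev[symmetric])
  finally show ?thesis unfolding harm by simp
qed

text \<open>
  The double sum is arranged by the value $k = d + e$; the increment in \<open>n\<close> is
  $2 H_n/(n+1)$, which is the increment of $H_n^2$ without its square term.
\<close>

lemma trunc_conv_inverse_inverse:
  "trunc_conv 1 1 (\<lambda>d. 1 / real d) (\<lambda>d. 1 / real d) n = (harm n)\<^sup>2 - (\<Sum>m\<le>n. 1 / (real m)\<^sup>2)"
proof -
  let ?r = "\<lambda>d. 1 / real d"
  have "trunc_conv 1 1 ?r ?r n = (\<Sum>(d, e)\<in>{..n} \<times> {..n}. of_bool (d + e \<le> n) * (?r d * ?r e))"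
    by (simp add: trunc_conv_def sum.cartesian_product)
  also have "\<dots> = (\<Sum>(d, e)\<in>{(d, e). d + e \<le> n}. ?r d * ?r e)"
    by (rule sum.mono_neutral_cong_right) auto
  also have "\<dots> = (\<Sum>k\<le>n. \<Sum>i\<le>k. ?r i * ?r (k - i))"
    by (rule sum.triangle_reindex_eq)
  also have "\<dots> = (harm n)\<^sup>2 - (\<Sum>m\<le>n. 1 / (real m)\<^sup>2)"
  proof (induction n)
    case (Suc n)
    have "(\<Sum>k\<le>Suc n. \<Sum>i\<le>k. ?r i * ?r (k - i)) =
            (harm n)\<^sup>2 - (\<Sum>m\<le>n. 1 / (real m)\<^sup>2) + 2 * harm n / real (Suc n)"
      unfolding sum.atMost_Suc[of _ n] sum_inverse_mult_reflected Suc.IH ..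
    also have "\<dots> = (harm (Suc n))\<^sup>2 - (\<Sum>m\<le>Suc n. 1 / (real m)\<^sup>2)"
      by (simp add: harm_Suc power2_sum inverse_eq_divide power_divide)
    finally show ?case .
  qed (simp add: harm_expand)
  finally show ?thesis .
qed

lemma sum_inverse_squares_error:
  assumes "n \<ge> 1"
  shows "\<bar>(\<Sum>m\<le>n. 1 / (real m)\<^sup>2) - pi\<^sup>2 / 6\<bar> \<le> 1 / real n"
proof -
  let ?P = "\<lambda>n. \<Sum>m\<le>n. 1 / (real m)\<^sup>2"
  have P_eq: "?P n = (\<Sum>k<n. 1 / (real k + 1)\<^sup>2)" for n
    by (induction n) (simp_all add: add.commute)
  have lim: "?P \<longlonglongrightarrow> pi\<^sup>2 / 6"
    using inverse_squares_sums unfolding sums_def P_eq by (simp add: add.commute)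
  have "incseq ?P" by (intro incseq_SucI) simp
  hence "?P n \<le> pi\<^sup>2 / 6" using lim by (rule incseq_le)
  \<comment> \<open>The tail is at most \<open>1 / n\<close>, as the partial sum plus \<open>1 / n\<close> decreases to the limit.\<close>
  moreover have "1 / (real (Suc (Suc k)))\<^sup>2 + 1 / real (Suc (Suc k)) \<le> 1 / real (Suc k)" for k
    by (simp add: divide_simps power2_eq_square) (simp add: algebra_simps)
  hence "decseq (\<lambda>k. ?P (Suc k) + 1 / real (Suc k))"
    by (intro decseq_SucI) (simp only: sum.atMost_Suc[of _ "Suc _"] add.assoc add_left_mono)
  moreover have "(\<lambda>k. ?P (Suc k) + 1 / real (Suc k)) \<longlonglongrightarrow> pi\<^sup>2 / 6 + 0"
    using LIMSEQ_Suc[OF lim] LIMSEQ_Suc[OF lim_1_over_n] by (rule tendsto_add)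
  ultimately have "?P n \<le> pi\<^sup>2 / 6" "pi\<^sup>2 / 6 + 0 \<le> ?P (Suc (n - 1)) + 1 / real (Suc (n - 1))"
    by (blast, intro decseq_ge)
  thus ?thesis using assms by simp
qed

lemma harm_error:
  assumes "n \<ge> 1"
  shows "\<bar>harm n - ln (real n) - euler_mascheroni\<bar> \<le> 1 / real n"
proof -
  have n: "real n > 0" using assms by simp
  have "ln (real (Suc n)) - ln (real n) = ln (1 + 1 / real n)"
    using n ln_div[of "real (Suc n)" "real n"]
    by (simp add: add_divide_distrib add.commute)
  moreover have "ln (1 + 1 / real n) \<le> 1 / real n" by (rule ln_add_one_self_le_self) simp
  moreover have "ln (1 + 1 / real n) \<ge> 0" using n by simp
  moreover have "inverse (real (2 * n)) \<le> 1 / real n" using n by (simp add: field_simps)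
  moreover have "inverse (real (2 * (n + 1))) \<ge> 0" by simp
  ultimately show ?thesis using euler_mascheroni_bounds[OF assms]
    unfolding atLeastAtMost_iff by linarith
qed

section \<open>The second moment about the logarithm\<close>

lemma bigo_of_bound:
  fixes f g :: "nat \<Rightarrow> real"
  assumes "\<And>n. n \<ge> 1 \<Longrightarrow> \<bar>f n\<bar> \<le> C * g n" "\<And>n. n \<ge> 1 \<Longrightarrow> g n \<ge> 0"
  shows "f \<in> O(g)"
  by (rule bigoI[where c = C], rule eventually_mono[OF eventually_ge_at_top[of 1]]) (use assms in simp)

lemma inverse_bigo_ln: "(\<lambda>n. 1 / real n) \<in> O(\<lambda>n. ln (real n) / real n)"
  by real_asymp

lemma harm_bigo: "(\<lambda>n. (harm n + 1) / real n) \<in> O(\<lambda>n. ln (real n) / real n)"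
proof -
  have "(\<lambda>n. harm n - ln (real n) - euler_mascheroni) \<in> O(\<lambda>n. 1 / real n)"
    by (rule bigo_of_bound[where C = 1]) (use harm_error in auto)
  moreover have "(\<lambda>n. 1 / real n) \<in> O(\<lambda>n. ln (real n))" by real_asymp
  ultimately have "(\<lambda>n. harm n - ln (real n) - euler_mascheroni) \<in> O(\<lambda>n. ln (real n))"
    by (rule landau_o.big_trans)
  moreover have "(\<lambda>n. ln (real n) + (euler_mascheroni + 1)) \<in> O(\<lambda>n. ln (real n))" by real_asymp
  ultimately have "(\<lambda>n. (harm n - ln (real n) - euler_mascheroni) + (ln (real n) + (euler_mascheroni + 1)))
                      \<in> O(\<lambda>n. ln (real n))"
    by (rule sum_in_bigo)
  hence "(\<lambda>n. harm n + 1) \<in> O(\<lambda>n. ln (real n))" by (simp add: algebra_simps)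
  hence "(\<lambda>n. (harm n + 1) * (1 / real n)) \<in> O(\<lambda>n. ln (real n) * (1 / real n))"
    by (rule landau_o.big.mult_right)
  thus ?thesis by simp
qed

lemma prime_weight_sum_bigo:
  assumes "k \<ge> 2"
  shows "(\<lambda>n. trunc_sum k (prime_weight TYPE('a::finite_field) k) n - Lsum TYPE('a) k) \<in> O(\<lambda>n. 1 / real n)"
  unfolding Lsum_eq_suminf[OF assms]
  by (rule bigo_of_bound[where C = "real k * first_moment (prime_weight TYPE('a) k)"])
     (use trunc_sum_error[OF summable_prime_weight[where 'a = 'a, OF assms], of k] assms in auto)

lemma trunc_sum_prime_weight_1:
  "trunc_sum 1 (prime_weight TYPE('a::finite_field) 1) n = harm n + trunc_sum 1 (prime_error TYPE('a)) n"
  unfolding trunc_sum_inverse_eq_harm[symmetric] by (simp add: trunc_sum_def prime_error_def sum_subtractf)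

text \<open>
  With \<open>trunc_sum_prime_weight_1\<close>, an analogue of Mertens' second theorem: the sum of $1/|l|$
  over $\deg l \le n$ is $H_n + c_1 + O(1/n)$.
\<close>

lemma mertens_bigo:
  "(\<lambda>n. trunc_sum 1 (prime_error TYPE('a::finite_field)) n - c1 TYPE('a)) \<in> O(\<lambda>n. 1 / real n)"
  unfolding c1_eq_suminf
  by (rule bigo_of_bound[where C = "first_moment (prime_error TYPE('a))"])
     (use trunc_sum_error[OF summable_prime_error[where 'a = 'a], of 1] in auto)

lemma trunc_conv_harmonic_bigo:
  assumes "summable (\<lambda>d. real d * \<bar>x d\<bar>)" "x 0 = 0"
    and "\<And>e. 0 \<le> v e" "\<And>e. v e \<le> 1 / real e" and "i \<ge> 1"
  shows "(\<lambda>n. trunc_conv i 1 x v n - trunc_sum 1 v n * (\<Sum>d. x d)) \<in> O(\<lambda>n. ln (real n) / real n)"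
proof (rule landau_o.big_trans[OF _ harm_bigo])
  show "(\<lambda>n. trunc_conv i 1 x v n - trunc_sum 1 v n * (\<Sum>d. x d)) \<in> O(\<lambda>n. (harm n + 1) / real n)"
    by (rule bigo_of_bound[where C = "real i * first_moment x"])
       (use trunc_conv_harmonic_error[OF assms] in \<open>auto simp: harm_nonneg mult_ac\<close>)
qed

lemma trunc_conv_add_left:
  "trunc_conv i j (\<lambda>d. x d + x' d) y n = trunc_conv i j x y n + trunc_conv i j x' y n"
  by (simp add: trunc_conv_def algebra_simps sum.distrib)

text \<open>
  Writing $a = r + \delta$ with $r_d = 1/d$, the convolution splits as
  $a * a = r * r + \delta * r + \delta * a$.
\<close>

lemma trunc_conv_prime_weight_1:
  defines "p \<equiv> prime_weight TYPE('a::finite_field) 1" and "\<delta> \<equiv> prime_error TYPE('a)"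
  shows "trunc_conv 1 1 p p n = (harm n)\<^sup>2 - (\<Sum>m\<le>n. 1 / (real m)\<^sup>2)
           + trunc_conv 1 1 \<delta> (\<lambda>d. 1 / real d) n + trunc_conv 1 1 \<delta> p n"
proof -
  let ?r = "\<lambda>d. 1 / real d"
  have p: "p = (\<lambda>d. ?r d + \<delta> d)" by (simp add: p_def \<delta>_def prime_error_def)
  have "trunc_conv 1 1 p p n = trunc_conv 1 1 ?r p n + trunc_conv 1 1 \<delta> p n"
    by (subst (1) p) (rule trunc_conv_add_left)
  also have "trunc_conv 1 1 ?r p n = trunc_conv 1 1 p ?r n" by (rule trunc_conv_commute)
  also have "\<dots> = trunc_conv 1 1 ?r ?r n + trunc_conv 1 1 \<delta> ?r n"
    by (subst (1) p) (rule trunc_conv_add_left)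
  finally show ?thesis by (simp only: trunc_conv_inverse_inverse)
qed

lemma omega1_second_moment:
  "(\<lambda>n. (\<Sum>f\<in>(monic_of_degree n :: 'a::finite_field poly set). (real (omega1 f) - ln (real n))\<^sup>2)
          - (real CARD('a) ^ n * ln (real n) + c3 TYPE('a) * real CARD('a) ^ n))
     \<in> O(\<lambda>n. real CARD('a) ^ n * ln (real n) / real n)"
proof -
  define p where "p = prime_weight TYPE('a)"
  define \<delta> where "\<delta> = prime_error TYPE('a)"
  define r :: "nat \<Rightarrow> real" where "r = (\<lambda>d. 1 / real d)"
  define l where "l = (\<lambda>n::nat. ln (real n))"
  let ?L = "Lsum TYPE('a)" and ?c1 = "c1 TYPE('a)" and ?\<gamma> = "euler_mascheroni :: real"
  \<comment> \<open>The functions \<open>h\<close> to \<open>v\<close> are the errors of the individual sums, and \<open>R\<close> is the error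
     that they produce in the second moment divided by $q^n$.\<close>
  define h where "h = (\<lambda>n. harm n - l n - ?\<gamma>)"
  define s where "s = (\<lambda>n. trunc_sum 1 \<delta> n - ?c1)"
  define z where "z = (\<lambda>n. (\<Sum>m\<le>n. 1 / (real m)\<^sup>2) - pi\<^sup>2 / 6)"
  define t where "t = (\<lambda>k n. trunc_sum k (p k) n - ?L k)"
  define a where "a = (\<lambda>n. trunc_conv 1 1 \<delta> r n - harm n * ?c1)"
  define b where "b = (\<lambda>n. trunc_conv 1 1 \<delta> (p 1) n - trunc_sum 1 (p 1) n * ?c1)"
  define u where "u = (\<lambda>n. trunc_conv 2 1 (p 2) (p 1) n - trunc_sum 1 (p 1) n * ?L 2)"
  define v where "v = (\<lambda>n. trunc_conv 2 2 (p 2) (p 2) n - (?L 2)\<^sup>2)"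
  define R where "R = (\<lambda>n. h n * h n + 2 * (l n * h n) + 2 * ?\<gamma> * h n - z n + ?c1 * h n + ?c1 * (h n + s n)
      + a n + b n - 2 * ?L 2 * (h n + s n) - 2 * u n + v n + (h n + s n) - 2 * t 2 n + 2 * t 3 n - t 4 n
      - 2 * (l n * (h n + s n)) + 2 * (l n * t 2 n))"
  have main: "(\<Sum>f\<in>(monic_of_degree n :: 'a poly set). (real (omega1 f) - ln (real n))\<^sup>2)
          - (real CARD('a) ^ n * ln (real n) + c3 TYPE('a) * real CARD('a) ^ n)
        = real CARD('a) ^ n * R n" for n
  proof -
    let ?M = "monic_of_degree n :: 'a poly set" and ?Q = "real CARD('a) ^ n"
    have F: "trunc_sum 1 (p 1) n = l n + ?\<gamma> + ?c1 + h n + s n"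
      unfolding p_def \<delta>_def s_def h_def trunc_sum_prime_weight_1 by simp
    have H: "harm n = l n + ?\<gamma> + h n" by (simp add: h_def)
    have D: "trunc_sum k (p k) n = ?L k + t k n" for k by (simp add: t_def)
    have T21: "trunc_conv 2 1 (p 2) (p 1) n = trunc_sum 1 (p 1) n * ?L 2 + u n" by (simp add: u_def)
    have T22: "trunc_conv 2 2 (p 2) (p 2) n = (?L 2)\<^sup>2 + v n" by (simp add: v_def)
    have T11: "trunc_conv 1 1 (p 1) (p 1) n = (harm n)\<^sup>2 - (pi\<^sup>2 / 6 + z n)
                 + (harm n * ?c1 + a n) + (trunc_sum 1 (p 1) n * ?c1 + b n)"
      using trunc_conv_prime_weight_1[where 'a = 'a, of n]
      by (simp add: p_def \<delta>_def z_def a_def b_def r_def)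
    have "(\<Sum>f\<in>?M. (real (omega1 f) - ln (real n))\<^sup>2) =
            (\<Sum>f\<in>?M. (real (omega1 f))\<^sup>2 - 2 * l n * real (omega1 f) + (l n)\<^sup>2)"
      by (intro sum.cong refl) (simp add: power2_diff l_def)
    also have "\<dots> = (\<Sum>f\<in>?M. (real (omega1 f))\<^sup>2) - 2 * l n * (\<Sum>f\<in>?M. real (omega1 f)) + ?Q * (l n)\<^sup>2"
      by (simp add: sum.distrib sum_subtractf sum_distrib_left card_monic_of_degree)
    also have "\<dots> = ?Q * ((trunc_conv 1 1 (p 1) (p 1) n - 2 * trunc_conv 2 1 (p 2) (p 1) n
        + trunc_conv 2 2 (p 2) (p 2) n + trunc_sum 1 (p 1) n - 2 * trunc_sum 2 (p 2) n
        + 2 * trunc_sum 3 (p 3) n - trunc_sum 4 (p 4) n)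
        - 2 * l n * (trunc_sum 1 (p 1) n - trunc_sum 2 (p 2) n) + (l n)\<^sup>2)"
      unfolding sum_omega1_squared sum_omega1 p_def[symmetric] by (simp only: algebra_simps)
    also have "\<dots> = ?Q * (l n + c3 TYPE('a) + R n)"
      unfolding T11 T21 T22 D[of 2] D[of 3] D[of 4] F H c3_def A1_def R_def
      by (simp add: power2_eq_square algebra_simps)
    finally show ?thesis by (simp add: l_def algebra_simps)
  qed

  let ?V = "\<lambda>n. l n / real n"
  have weaken: "f \<in> O(?V)" if "f \<in> O(\<lambda>n. 1 / real n)" for f :: "nat \<Rightarrow> real"
    using landau_o.big_trans[OF that inverse_bigo_ln] by (simp add: l_def)
  have times_l: "(\<lambda>n. l n * f n) \<in> O(?V)" if "f \<in> O(\<lambda>n. 1 / real n)" for f :: "nat \<Rightarrow> real"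
    using landau_o.big.mult_left[OF that, of l] by simp
  have h: "h \<in> O(\<lambda>n. 1 / real n)"
    by (rule bigo_of_bound[where C = 1]) (use harm_error in \<open>auto simp: h_def l_def\<close>)
  have s: "s \<in> O(\<lambda>n. 1 / real n)"
    unfolding s_def \<delta>_def by (rule mertens_bigo)
  have hs: "(\<lambda>n. h n + s n) \<in> O(\<lambda>n. 1 / real n)" using h s by (rule sum_in_bigo)
  have z: "z \<in> O(\<lambda>n. 1 / real n)"
    by (rule bigo_of_bound[where C = 1]) (use sum_inverse_squares_error in \<open>auto simp: z_def\<close>)
  have t: "t k \<in> O(\<lambda>n. 1 / real n)" if "k \<ge> 2" for k
    unfolding t_def p_def by (rule prime_weight_sum_bigo[OF that])
  have v: "v \<in> O(\<lambda>n. 1 / real n)"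
  proof (rule bigo_of_bound)
    fix n :: nat assume "n \<ge> 1"
    thus "\<bar>v n\<bar> \<le> 4 * first_moment (p 2) * first_moment (p 2) * (1 / real n)"
      using trunc_conv_summable_error[OF summable_prime_weight[where 'a = 'a, of 2] _
          summable_prime_weight[where 'a = 'a, of 2], of 2 2 n]
      by (simp add: v_def p_def Lsum_eq_suminf power2_eq_square)
  qed simp
  have a: "a \<in> O(?V)"
    using trunc_conv_harmonic_bigo[of \<delta> r 1] summable_prime_error[where 'a = 'a]
    unfolding a_def c1_eq_suminf trunc_sum_inverse_eq_harm[symmetric] r_def l_def
    by (simp add: \<delta>_def)
  have b: "b \<in> O(?V)"
    unfolding b_def c1_eq_suminf p_def \<delta>_def l_def
    by (rule trunc_conv_harmonic_bigo)
       (simp_all only: summable_prime_error prime_error_0 prime_weight_nonneg prime_weight_1_le order_refl)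
  have u: "u \<in> O(?V)"
    unfolding u_def Lsum_eq_suminf[OF order_refl] p_def l_def
    by (rule trunc_conv_harmonic_bigo)
       (simp_all only: summable_prime_weight prime_weight_0 prime_weight_nonneg prime_weight_1_le order_refl one_le_numeral)
  have hh: "(\<lambda>n. h n * h n) \<in> O(?V)"
  proof (rule weaken)
    have "(\<lambda>n. h n * h n) \<in> O(\<lambda>n. (1 / real n) * (1 / real n))" using h h by (rule landau_o.big.mult)
    also have "(\<lambda>n. (1 / real n) * (1 / real n)) \<in> O(\<lambda>n. 1 / real n)" by real_asymp
    finally show "(\<lambda>n. h n * h n) \<in> O(\<lambda>n. 1 / real n)" .
  qed
  \<comment> \<open>Each term of \<open>R\<close> is $O(1/n)$, $\log n$ times $O(1/n)$, or $O(\log n / n)$.\<close>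
  have scale: "(\<lambda>n. c * f n) \<in> O(?V)" if "f \<in> O(?V)" for c :: real and f :: "nat \<Rightarrow> real"
    using that by (cases "c = 0") simp_all
  have "t 2 \<in> O(\<lambda>n. 1 / real n)" "t 3 \<in> O(\<lambda>n. 1 / real n)" "t 4 \<in> O(\<lambda>n. 1 / real n)"
    by (simp_all add: t)
  note terms = hh scale[OF times_l[OF h]] scale[OF weaken[OF h]] weaken[OF z] scale[OF weaken[OF hs]]
    a b scale[OF u] weaken[OF v] weaken[OF h] weaken[OF s] scale[OF weaken[OF this(1)]]
    scale[OF weaken[OF this(2)]] weaken[OF this(3)] scale[OF times_l[OF hs]] scale[OF times_l[OF this(1)]]
  have "R \<in> O(?V)"
    unfolding R_def by (intro sum_in_bigo terms)
  hence "(\<lambda>n. real CARD('a) ^ n * R n) \<in> O(\<lambda>n. real CARD('a) ^ n * ?V n)"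
    by (rule landau_o.big.mult_left)
  thus ?thesis unfolding main by (simp add: l_def)
qed

lemma omega1_second_moment_bigo:
  "(\<lambda>n. \<Sum>f\<in>(monic_of_degree n :: 'a::finite_field poly set). (real (omega1 f) - ln (real n))\<^sup>2)
     \<in> O(\<lambda>n. real CARD('a) ^ n * ln (real n))"
proof -
  let ?q = "real CARD('a)"
  have "(\<lambda>n. ln (real n) / real n) \<in> O(\<lambda>n. ln (real n))" by real_asymp
  hence "(\<lambda>n. ?q ^ n * (ln (real n) / real n)) \<in> O(\<lambda>n. ?q ^ n * ln (real n))"
    by (rule landau_o.big.mult_left)
  hence "(\<lambda>n. ?q ^ n * ln (real n) / real n) \<in> O(\<lambda>n. ?q ^ n * ln (real n))" by simp
  note error = landau_o.big_trans[OF omega1_second_moment[where 'a = 'a] this]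
  have "(\<lambda>n. ln (real n) + c3 TYPE('a)) \<in> O(\<lambda>n. ln (real n))" by real_asymp
  hence "(\<lambda>n. ?q ^ n * (ln (real n) + c3 TYPE('a))) \<in> O(\<lambda>n. ?q ^ n * ln (real n))"
    by (rule landau_o.big.mult_left)
  from sum_in_bigo(1)[OF error this] show ?thesis by (simp add: algebra_simps)
qed

section \<open>Concentration and normal order\<close>

text \<open>
  Chebyshev's inequality for the counting measure on \<open>A\<close>.
\<close>

lemma card_deviation_le:
  fixes X :: "'b \<Rightarrow> real"
  assumes "finite A" "t \<ge> 0"
  shows "real (card {f \<in> A. \<bar>X f - m\<bar> \<ge> t}) * t\<^sup>2 \<le> (\<Sum>f\<in>A. (X f - m)\<^sup>2)"
proof -
  have "real (card {f \<in> A. \<bar>X f - m\<bar> \<ge> t}) * t\<^sup>2 = (\<Sum>f | f \<in> A \<and> \<bar>X f - m\<bar> \<ge> t. t\<^sup>2)" by simp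
  also have "\<dots> \<le> (\<Sum>f | f \<in> A \<and> \<bar>X f - m\<bar> \<ge> t. (X f - m)\<^sup>2)"
    using assms(2) by (intro sum_mono) (auto simp flip: abs_le_square_iff)
  also have "\<dots> \<le> (\<Sum>f\<in>A. (X f - m)\<^sup>2)" using assms(1) by (intro sum_mono2) auto
  finally show ?thesis .
qed

text \<open>
  Deviations of size \<open>t n\<close> from $\log n$ are rare as soon as $t_n^2$ dominates $\log n$.
\<close>

lemma omega1_few_deviations:
  fixes t :: "nat \<Rightarrow> real"
  assumes pos: "\<forall>\<^sub>F n in at_top. t n > 0" and lim: "(\<lambda>n. ln (real n) / (t n)\<^sup>2) \<longlonglongrightarrow> 0"
    and B: "\<forall>\<^sub>F n in at_top. B n \<subseteq> {f \<in> (monic_of_degree n :: 'a::finite_field poly set).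
                                      \<bar>real (omega1 f) - ln (real n)\<bar> \<ge> t n}"
  shows "(\<lambda>n. real (card (B n))) \<in> o(\<lambda>n. real CARD('a) ^ n)"
proof -
  let ?q = "real CARD('a)" and ?M = "\<lambda>n. monic_of_degree n :: 'a poly set"
  let ?S = "\<lambda>n. \<Sum>f\<in>?M n. (real (omega1 f) - ln (real n))\<^sup>2"
  have "(\<lambda>n. real (card (B n))) \<in> O(\<lambda>n. ?S n * (1 / (t n)\<^sup>2))"
  proof (rule bigoI[where c = 1], use pos B in eventually_elim)
    case (elim n)
    have "real (card (B n)) * (t n)\<^sup>2 \<le>
            real (card {f \<in> ?M n. \<bar>real (omega1 f) - ln (real n)\<bar> \<ge> t n}) * (t n)\<^sup>2"
      using elim(2) by (intro mult_right_mono of_nat_mono card_mono) auto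
    also have "\<dots> \<le> ?S n"
      using elim(1) by (intro card_deviation_le) auto
    finally have "real (card (B n)) \<le> ?S n * (1 / (t n)\<^sup>2)" using elim(1) by (simp add: field_simps)
    thus ?case by (simp add: sum_nonneg)
  qed
  also have "(\<lambda>n. ?S n * (1 / (t n)\<^sup>2)) \<in> O(\<lambda>n. ?q ^ n * ln (real n) * (1 / (t n)\<^sup>2))"
    by (rule landau_o.big.mult_right[OF omega1_second_moment_bigo])
  also have "(\<lambda>n. ?q ^ n * ln (real n) * (1 / (t n)\<^sup>2)) \<in> o(\<lambda>n. ?q ^ n)"
  proof (rule smalloI_tendsto)
    show "(\<lambda>n. ?q ^ n * ln (real n) * (1 / (t n)\<^sup>2) / ?q ^ n) \<longlonglongrightarrow> 0" using lim by simp
  qed simp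
  finally show ?thesis .
qed

lemma omega1_concentration:
  assumes "0 < \<epsilon>"
  shows "(\<lambda>n. real (card {f \<in> (monic_of_degree n :: 'a::finite_field poly set).
            \<bar>real (omega1 f) - ln (real n)\<bar> / sqrt (ln (real n)) \<ge> ln (real n) powr \<epsilon>}))
          \<in> o(\<lambda>n. real CARD('a) ^ n)"
proof (rule omega1_few_deviations[where t = "\<lambda>n. sqrt (ln (real n)) * ln (real n) powr \<epsilon>"])
  have ln_pos: "\<forall>\<^sub>F n in at_top. ln (real n) > 0" by real_asymp
  thus "\<forall>\<^sub>F n in at_top. sqrt (ln (real n)) * ln (real n) powr \<epsilon> > 0"
    by eventually_elim simp
  show "(\<lambda>n. ln (real n) / (sqrt (ln (real n)) * ln (real n) powr \<epsilon>)\<^sup>2) \<longlonglongrightarrow> 0"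
    using assms by real_asymp
  show "\<forall>\<^sub>F n in at_top. {f \<in> (monic_of_degree n :: 'a poly set).
            \<bar>real (omega1 f) - ln (real n)\<bar> / sqrt (ln (real n)) \<ge> ln (real n) powr \<epsilon>}
          \<subseteq> {f \<in> monic_of_degree n. \<bar>real (omega1 f) - ln (real n)\<bar>
               \<ge> sqrt (ln (real n)) * ln (real n) powr \<epsilon>}"
    using ln_pos by eventually_elim (auto simp: le_divide_eq mult.commute)
qed

lemma omega1_normal_order:
  "has_normal_order (\<lambda>f::'a::finite_field poly. real (omega1 f)) (\<lambda>f. ln (real (degree f)))"
  unfolding has_normal_order_def
proof (intro conjI allI impI ballI)
  fix f :: "'a poly" assume "f \<in> monic_nonconst"
  thus "0 \<le> ln (real (degree f))" by (simp add: monic_nonconst_def)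
next
  show "nondecreasing_in_degree (\<lambda>f::'a poly. ln (real (degree f)))"
    by (auto simp: nondecreasing_in_degree_def monic_nonconst_def)
next
  fix \<epsilon> :: real assume \<epsilon>: "\<epsilon> > 0"
  show "(\<lambda>n. real (card {f \<in> (monic_of_degree n :: 'a poly set).
            \<not> ((1 - \<epsilon>) * ln (real (degree f)) \<le> real (omega1 f) \<and>
               real (omega1 f) \<le> (1 + \<epsilon>) * ln (real (degree f)))}))
          \<in> o(\<lambda>n. real CARD('a) ^ n)"
  proof (rule omega1_few_deviations[where t = "\<lambda>n. \<epsilon> * ln (real n)"])
    show "\<forall>\<^sub>F n in at_top. \<epsilon> * ln (real n) > 0" using \<epsilon> by real_asymp
    show "(\<lambda>n. ln (real n) / (\<epsilon> * ln (real n))\<^sup>2) \<longlonglongrightarrow> 0" using \<epsilon> by real_asymp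
    have "\<epsilon> * y \<le> \<bar>x - y\<bar>" if "\<not> ((1 - \<epsilon>) * y \<le> x \<and> x \<le> (1 + \<epsilon>) * y)" for x y :: real
      using that by (auto simp: algebra_simps)
    thus "\<forall>\<^sub>F n in at_top. {f \<in> (monic_of_degree n :: 'a poly set).
            \<not> ((1 - \<epsilon>) * ln (real (degree f)) \<le> real (omega1 f) \<and>
               real (omega1 f) \<le> (1 + \<epsilon>) * ln (real (degree f)))}
          \<subseteq> {f \<in> monic_of_degree n. \<bar>real (omega1 f) - ln (real n)\<bar> \<ge> \<epsilon> * ln (real n)}"
      by (intro always_eventually allI) (auto simp: monic_of_degree_def)
  qed
qed simp

theorem theorem1p3:
  shows "(\<lambda>n. (\<Sum>f\<in>(monic_of_degree n :: 'a::finite_field poly set).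
                  (real (omega1 f) - ln (real n))\<^sup>2)
              - (real CARD('a) ^ n * ln (real n) + c3 TYPE('a) * real CARD('a) ^ n))
           \<in> O(\<lambda>n. real CARD('a) ^ n * ln (real n) / real n)
    \<and> (\<forall>\<epsilon>'::real. 0 < \<epsilon>' \<and> \<epsilon>' < 1/2 \<longrightarrow>
          (\<lambda>n. real (card {f \<in> (monic_of_degree n :: 'a poly set).
                  \<bar>real (omega1 f) - ln (real n)\<bar> / sqrt (ln (real n)) \<ge> ln (real n) powr \<epsilon>'}))
            \<in> o(\<lambda>n. real CARD('a) ^ n))
    \<and> has_normal_order (\<lambda>f::'a poly. real (omega1 f)) (\<lambda>f. ln (real (degree f)))"
  using omega1_second_moment omega1_concentration omega1_normal_order by blast

end
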